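(* Let $r,s\in\{1,-1\}$, let $a,b$ be indeterminates, and put $\delta=b^2-a^2$. For every oriented extended welded link diagram $L$, let $[L]$ be the rational function of $a,b$ (depending also on $r,s$) determined by the skein relations $$[L_+]=a\,[L_v]+b\,[L_o]+b\,[L_u],\qquad [L_-]=-\frac{a}{\delta}\,[L_v]+\frac{b}{\delta}\,[L_o]+\frac{b}{\delta}\,[L_u],$$ $$[L\cup\bigcirc]=-2\,[L],\qquad [L_{\mathrm{vk}}]=r\,[L_{\mathrm{arc}}],\qquad [L_{\mathrm{wen}}]=s\,[L_{\mathrm{arc}}].$$ Let $w(L)$ be the writhe of $L$ and $v(L)$ the number of virtual (welded) crossings of $L$. Then the quantity $$Y(L)=r^{v(L)}\,(ar-b)^{-w(L)}\,[L]$$ is an invariant of extended welded links; that is, $Y(L)=Y(L')$ whenever $L$ and $L'$ are diagrams of the same oriented extended welded link.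
   Context: **Diagrams.** An oriented extended welded link diagram is a generic immersion of finitely many oriented circles in the plane whose only singularities are transverse double points, together with finitely many wen marks placed on the arcs away from the double points. Each double point is either a classical crossing (with over/under information) or a virtual crossing, also called a welded crossing (a plain intersection with no over/under information). A classical crossing is positive if the (over-strand direction, under-strand direction) pair is a positively oriented basis of the plane, and negative otherwise. The writhe is $w(L)=\#\{\text{positive classical crossings}\}-\#\{\text{negative classical crossings}\}$. The number $v(L)$ (the virtual writhe) is the number of virtual crossings of $L$. **Moves.** Two diagrams represent the same oriented extended welded link if they are related by planar isotopy and finitely many of the following local moves and their inverses (with all orientations of the strands allowed). - R1, R2, R3: the classical Reidemeister moves. R1 adds or removes a kink with one classical crossing of either sign (R1a: positive, R1b: negative). R2 adds or removes two classical crossings between two strands, the same strand being over at both. R3 is the usual triangle move with three classical crossings. - V1, V2, V3: the same three moves with every crossing virtual. - M: a strand meeting two other strands in virtual crossings is moved across the classical crossing of those two strands. - F1: a strand passing over two other strands (at two classical crossings) is moved across the virtual crossing of those two strands, remaining over both; that is, a virtual crossing may pass under another strand. - T1: two consecutive wen marks on an arc may be removed. - T2: a wen mark may slide along its strand through a virtual crossing. - T3: a wen mark on the under-strand of a classical crossing may slide along that strand through the crossing. - T4: a wen mark on the over-strand of a classical crossing may slide along that strand through the crossing, at the cost of replacing the crossing by a sequence of three crossings of the same two strands: virtual, then classical, then virtual. The same strand remains over at the classical crossing, and the new classical crossing has sign opposite to the original one. In braid-like position with both strands pointing downward, the move replaces a positive crossing whose over-strand runs from top right to bottom left, with a wen on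 the top right end, by (virtual crossing)(negative classical crossing)(virtual crossing) stacked vertically, with the strand that starts at top right still over, and the wen at the bottom left end. **Skein notation.** - $L_+$, $L_-$, $L_v$, $L_o$, $L_u$ denote diagrams that are identical outside a small disk. Inside the disk, $L_+$ has a positive classical crossing and $L_-$ a negative classical crossing. $L_v$ has a virtual crossing of the same two strands. $L_o$ has the oriented smoothing, joining each incoming end to the outgoing end on the same side (drawn as $)($ when both strands point downward). $L_u$ has the other planar smoothing, joining the two incoming ends to each other and the two outgoing ends to each other. The bracket is extended to unoriented diagrams with only virtual crossings and wen marks, which is what one obtains after all classical crossings have been expanded. - $L\cup\bigcirc$ is $L$ together with a disjoint embedded circle that meets nothing. - $L_{\mathrm{vk}}$ has a kink with a single virtual crossing (a virtual kink), and $L_{\mathrm{wen}}$ an arc carrying one wen mark, where $L_{\mathrm{arc}}$ has a plain arc. **Evaluation of the bracket.** Applying the first two skein relations to every classical crossing of $L$ writes $[L]$ as a linear combination of brackets of $3^{\#\text{classical crossings}}$ states, each an unoriented diagram with only virtual crossings and wen marks. States are evaluated up to planar isotopy and the moves V2 and V3 (under which the bracket is taken to be unchanged), together with the last three skein relations and the normalization $[\emptyset]=1$. Explicitly, a state $S$ consisting of $c(S)$ immersed circles with $v(S)$ virtual crossings and $m(S)$ wen marks in total has value $[S]=r^{v(S)}s^{m(S)}(-2)^{c(S)}$. *)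

theory Defs
  imports
    "HOL-Analysis.Analysis"
    "HOL-Computational_Algebra.Polynomial"
    "HOL-Computational_Algebra.Fraction_Field"
begin

section \<open>Diagrams\<close>

text \<open>
  The plane is the type of complex numbers, and a circle is the reals modulo 1.  A link diagram
  consists of 1-periodic curves, oriented by their parametrization.  A point of the (disjoint
  union of the) circles is a pair of a component index and a parameter in the interval
  from 0 (included) to 1 (excluded).

  The field \<open>over\<close> contains the parameter points at which a strand runs over another one at a
  classical crossing.  A double point is hence a classical crossing if one of its two preimages
  lies in \<open>over\<close>, and a virtual crossing if none of them does.
\<close>

type_synonym point = "nat \<times> real"

record diagram =
  curves :: "(real \<Rightarrow> complex) list"
  over :: "point set"
  wens :: "point set"

definition points :: "diagram \<Rightarrow> point set" where
  "points D = {..<length (curves D)} \<times> {0..<1}"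

definition pos :: "diagram \<Rightarrow> point \<Rightarrow> complex" where
  "pos D p = (curves D ! fst p) (snd p)"

definition dir :: "diagram \<Rightarrow> point \<Rightarrow> complex" where
  "dir D p = vector_derivative (curves D ! fst p) (at (snd p))"

definition det2 :: "complex \<Rightarrow> complex \<Rightarrow> real" where
  "det2 u v = Re u * Im v - Im u * Re v"

definition immersed_circle :: "(real \<Rightarrow> complex) \<Rightarrow> bool" where
  "immersed_circle c \<longleftrightarrow>
     (\<forall>t. c (t + 1) = c t) \<and> c C1_differentiable_on UNIV \<and>
     (\<forall>t. vector_derivative c (at t) \<noteq> 0)"

definition double_pair :: "diagram \<Rightarrow> point \<Rightarrow> point \<Rightarrow> bool" where
  "double_pair D p q \<longleftrightarrow> p \<in> points D \<and> q \<in> points D \<and> p \<noteq> q \<and> pos D p = pos D q"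

definition passages :: "diagram \<Rightarrow> point set" where
  "passages D = {p. \<exists>q. double_pair D p q}"

definition partner :: "diagram \<Rightarrow> point \<Rightarrow> point" where
  "partner D p = (THE q. double_pair D p q)"

definition is_diagram :: "diagram \<Rightarrow> bool" where
  "is_diagram D \<longleftrightarrow>
     (\<forall>c\<in>set (curves D). immersed_circle c) \<and>
     finite (passages D) \<and>
     (\<forall>p q q'. double_pair D p q \<and> double_pair D p q' \<longrightarrow> q = q') \<and>
     (\<forall>p q. double_pair D p q \<longrightarrow> det2 (dir D p) (dir D q) \<noteq> 0) \<and>
     over D \<subseteq> passages D \<and>
     (\<forall>p\<in>over D. partner D p \<notin> over D) \<and>
     finite (wens D) \<and> wens D \<subseteq> points D - passages D"

definition positive :: "diagram \<Rightarrow> point \<Rightarrow> bool" where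
  "positive D p \<longleftrightarrow> det2 (dir D p) (dir D (partner D p)) > 0"

definition writhe :: "diagram \<Rightarrow> int" where
  "writhe D = int (card {p \<in> over D. positive D p}) - int (card {p \<in> over D. \<not> positive D p})"

definition virtual_writhe :: "diagram \<Rightarrow> nat" where
  "virtual_writhe D =
     card (pos D ` {p \<in> passages D. p \<notin> over D \<and> partner D p \<notin> over D})"


section \<open>Planar isotopy\<close>

definition plane_diffeo :: "(complex \<Rightarrow> complex) \<Rightarrow> bool" where
  "plane_diffeo \<phi> \<longleftrightarrow> bij \<phi> \<and>
     (\<exists>\<phi>' :: complex \<Rightarrow> (complex \<Rightarrow>\<^sub>L complex).
        continuous_on UNIV \<phi>' \<and>
        (\<forall>z. (\<phi> has_derivative blinfun_apply (\<phi>' z)) (at z) \<and>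
             det2 (blinfun_apply (\<phi>' z) 1) (blinfun_apply (\<phi>' z) \<i>) > 0))"

definition ambient_isotopy :: "(real \<Rightarrow> complex \<Rightarrow> complex) \<Rightarrow> bool" where
  "ambient_isotopy H \<longleftrightarrow>
     continuous_on ({0..1} \<times> UNIV) (\<lambda>(u, z). H u z) \<and>
     (\<forall>u\<in>{0..1}. plane_diffeo (H u)) \<and> H 0 = id"

definition circle_reparam :: "(real \<Rightarrow> real) \<Rightarrow> bool" where
  "circle_reparam h \<longleftrightarrow> continuous_on UNIV h \<and> strict_mono h \<and> (\<forall>t. h (t + 1) = h t + 1)"

text \<open>
  Diagrams do not come with a numbering of the components or a parametrization of the circles, so
  these may change as well.
\<close>

definition planar_isotopic :: "diagram \<Rightarrow> diagram \<Rightarrow> bool" where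
  "planar_isotopic D D' \<longleftrightarrow>
     (\<exists>H \<pi> h. ambient_isotopy H \<and>
        bij_betw \<pi> {..<length (curves D)} {..<length (curves D')} \<and>
        (\<forall>i<length (curves D).
           circle_reparam (h i) \<and>
           (\<forall>t. (curves D' ! \<pi> i) t = H 1 ((curves D ! i) (h i t))) \<and>
           (\<forall>t\<in>{0..<1}.
              ((\<pi> i, t) \<in> over D' \<longleftrightarrow> (i, frac (h i t)) \<in> over D) \<and>
              ((\<pi> i, t) \<in> wens D' \<longleftrightarrow> (i, frac (h i t)) \<in> wens D))))"


section \<open>Local moves\<close>

text \<open>
  A tangle is a picture in the standard square, each strand being parametrized by the interval
  from -1 to 1; as for diagrams, double points without an over-strand are virtual crossings.
  All tangles below have strands which start at the top side and end at the bottom side of the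
  square, vertically, and whose other points are interior points of the square.
\<close>

record tangle =
  strands :: "(real \<Rightarrow> complex) list"
  tover :: "point set"
  twens :: "point set"

definition square :: "complex set" where
  "square = {z. \<bar>Re z\<bar> \<le> 1 \<and> \<bar>Im z\<bar> \<le> 1}"

text \<open>
  The part of the diagram \<open>D\<close> in the disk \<open>\<phi> ` square\<close> is the image of the tangle \<open>T\<close>: its
  \<open>k\<close>-th strand is the parameter interval from \<open>\<alpha> k\<close> to \<open>\<beta> k\<close> on component \<open>i k\<close>.  As
  \<open>\<rho> k\<close> may be increasing or decreasing, the strands can have any orientation.
\<close>

definition sits_in ::
    "(complex \<Rightarrow> complex) \<Rightarrow> (nat \<Rightarrow> nat) \<Rightarrow> (nat \<Rightarrow> real) \<Rightarrow> (nat \<Rightarrow> real) \<Rightarrow>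
     (nat \<Rightarrow> real \<Rightarrow> real) \<Rightarrow> tangle \<Rightarrow> diagram \<Rightarrow> bool" where
  "sits_in \<phi> i \<alpha> \<beta> \<rho> T D \<longleftrightarrow>
     (\<forall>k<length (strands T).
        i k < length (curves D) \<and> 0 < \<alpha> k \<and> \<alpha> k < \<beta> k \<and> \<beta> k < 1 \<and>
        continuous_on {\<alpha> k..\<beta> k} (\<rho> k) \<and> bij_betw (\<rho> k) {\<alpha> k..\<beta> k} {-1..1} \<and>
        (\<forall>t\<in>{\<alpha> k..\<beta> k}.
           (curves D ! i k) t = \<phi> ((strands T ! k) (\<rho> k t)) \<and>
           ((i k, t) \<in> over D \<longleftrightarrow> (k, \<rho> k t) \<in> tover T) \<and>
           ((i k, t) \<in> wens D \<longleftrightarrow> (k, \<rho> k t) \<in> twens T))) \<and>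
     disjoint_family_on (\<lambda>k. {i k} \<times> {\<alpha> k..\<beta> k}) {..<length (strands T)} \<and>
     {p \<in> points D. pos D p \<in> \<phi> ` square} = (\<Union>k<length (strands T). {i k} \<times> {\<alpha> k..\<beta> k})"

text \<open>
  Replacing the tangle \<open>T\<close> in a disk by the tangle \<open>T'\<close>.  In every move below, corresponding
  strands of the two tangles have the same endpoints.
\<close>

definition local_move :: "tangle \<Rightarrow> tangle \<Rightarrow> diagram \<Rightarrow> diagram \<Rightarrow> bool" where
  "local_move T T' D D' \<longleftrightarrow>
     (\<exists>\<phi> i \<alpha> \<beta> \<rho> \<rho>'. plane_diffeo \<phi> \<and>
        sits_in \<phi> i \<alpha> \<beta> \<rho> T D \<and> sits_in \<phi> i \<alpha> \<beta> \<rho>' T' D' \<and>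
        length (curves D) = length (curves D') \<and>
        (\<forall>p \<in> points D - (\<Union>k<length (strands T). {i k} \<times> {\<alpha> k..\<beta> k}).
           pos D p = pos D' p \<and> (p \<in> over D \<longleftrightarrow> p \<in> over D') \<and> (p \<in> wens D \<longleftrightarrow> p \<in> wens D')))"

text \<open>
  Braid-like tangles: the strands are graphs over the vertical axis, at height \<open>-t\<close>, and
  \<open>K k l t\<close> says that strand \<open>k\<close> is over strand \<open>l\<close> at their crossing at height \<open>-t\<close>.
\<close>

definition braidlike ::
    "(real \<Rightarrow> real) list \<Rightarrow> (nat \<Rightarrow> nat \<Rightarrow> real \<Rightarrow> bool) \<Rightarrow> point set \<Rightarrow> tangle" where
  "braidlike xs K W =
     \<lparr> strands = map (\<lambda>x t. Complex (x t) (- t)) xs,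
       tover = {(k, t). k < length xs \<and> t \<in> {-1..1} \<and>
                        (\<exists>l<length xs. l \<noteq> k \<and> (xs ! l) t = (xs ! k) t \<and> K k l t)},
       twens = W \<rparr>"

text \<open>
  \<open>swap1\<close> runs from -1/2 to 1/2, with a zero at 0; \<open>swap3\<close> as well, but with two further zeros
  near -0.66 and 0.66; \<open>swap2\<close> runs from -1/2 to -1/2, with two zeros.  All zeros are simple,
  and the derivatives at -1 and 1 vanish.
\<close>

definition swap1 :: "real \<Rightarrow> real" where
  "swap1 t = (3 * t - t ^ 3) / 4"

definition swap2 :: "real \<Rightarrow> real" where
  "swap2 t = (1 - t\<^sup>2)\<^sup>2 - 1 / 2"

definition swap3 :: "real \<Rightarrow> real" where
  "swap3 t = swap1 t - 2 * t * (1 - t\<^sup>2)\<^sup>2"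

text \<open>
  Two strands crossing once, twice and three times.  Strand 0 starts at the top left, strand 1 at
  the top right.
\<close>

definition cross1 :: "(nat \<Rightarrow> nat \<Rightarrow> real \<Rightarrow> bool) \<Rightarrow> point set \<Rightarrow> tangle" where
  "cross1 = braidlike [swap1, \<lambda>t. - swap1 t]"

definition cross2 :: "(nat \<Rightarrow> nat \<Rightarrow> real \<Rightarrow> bool) \<Rightarrow> point set \<Rightarrow> tangle" where
  "cross2 = braidlike [swap2, \<lambda>t. - swap2 t]"

definition cross3 :: "(nat \<Rightarrow> nat \<Rightarrow> real \<Rightarrow> bool) \<Rightarrow> point set \<Rightarrow> tangle" where
  "cross3 = braidlike [swap3, \<lambda>t. - swap3 t]"

definition parallel2 :: tangle where
  "parallel2 = braidlike [\<lambda>_. - 1 / 2, \<lambda>_. 1 / 2] (\<lambda>_ _ _. False) {}"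

text \<open>
  Strands 0 and 2 cross at the centre, strand 1 passes to the right (\<open>e = 1\<close>) or to the
  left (\<open>e = -1\<close>) of their crossing.
\<close>

definition triangle :: "real \<Rightarrow> (nat \<Rightarrow> nat \<Rightarrow> bool) \<Rightarrow> tangle" where
  "triangle e K =
     braidlike [swap1, \<lambda>t. e * (1 - t\<^sup>2)\<^sup>2 / 2, \<lambda>t. - swap1 t] (\<lambda>k l _. K k l) {}"

definition line :: "point set \<Rightarrow> tangle" where
  "line W = braidlike [\<lambda>_. 0] (\<lambda>_ _ _. False) W"

text \<open>
  A strand whose only double point is that at the parameters -1/2 and 1/2, with the loop to the
  right (\<open>e = 1\<close>) or to the left (\<open>e = -1\<close>).
\<close>

definition kink :: "real \<Rightarrow> point set \<Rightarrow> tangle" where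
  "kink e ov =
     \<lparr> strands = [\<lambda>t. Complex (e * 3 / 4 * (1 - t\<^sup>2)\<^sup>2) (- (t * (4 * t\<^sup>2 - 1) / 3))],
       tover = ov, twens = {} \<rparr>"

inductive moves :: "tangle \<Rightarrow> tangle \<Rightarrow> bool" where
  R1: "e \<in> {-1, 1} \<Longrightarrow> \<tau> \<in> {-1/2, 1/2} \<Longrightarrow> moves (kink e {(0, \<tau>)}) (line {})"
| R2: "j < 2 \<Longrightarrow> moves (cross2 (\<lambda>k l _. k = j) {}) parallel2"
| R3: "inj_on (ht :: nat \<Rightarrow> nat) {0, 1, 2} \<Longrightarrow>
       moves (triangle 1 (\<lambda>k l. ht k > ht l)) (triangle (-1) (\<lambda>k l. ht k > ht l))"
| V1: "e \<in> {-1, 1} \<Longrightarrow> moves (kink e {}) (line {})"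
| V2: "moves (cross2 (\<lambda>_ _ _. False) {}) parallel2"
| V3: "moves (triangle 1 (\<lambda>_ _. False)) (triangle (-1) (\<lambda>_ _. False))"
| M:  "i < 3 \<Longrightarrow> j < 3 \<Longrightarrow> i \<noteq> j \<Longrightarrow>
       moves (triangle 1 (\<lambda>k l. k = i \<and> l = j)) (triangle (-1) (\<lambda>k l. k = i \<and> l = j))"
| F1: "j < 3 \<Longrightarrow> moves (triangle 1 (\<lambda>k l. k = j)) (triangle (-1) (\<lambda>k l. k = j))"
| T1: "moves (line {(0, -1/2), (0, 1/2)}) (line {})"
| T2: "j < 2 \<Longrightarrow>
       moves (cross1 (\<lambda>_ _ _. False) {(j, -3/4)}) (cross1 (\<lambda>_ _ _. False) {(j, 3/4)})"
| T3: "i < 2 \<Longrightarrow> j < 2 \<Longrightarrow> i \<noteq> j \<Longrightarrow>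
       moves (cross1 (\<lambda>k l _. k = i) {(j, -3/4)}) (cross1 (\<lambda>k l _. k = i) {(j, 3/4)})"
| T4: "j < 2 \<Longrightarrow> e \<in> {-3/4, 3/4} \<Longrightarrow>
       moves (cross1 (\<lambda>k l _. k = j) {(j, e)}) (cross3 (\<lambda>k l t. k = j \<and> t = 0) {(j, - e)})"

definition elementary_move :: "diagram \<Rightarrow> diagram \<Rightarrow> bool" where
  "elementary_move D D' \<longleftrightarrow> is_diagram D \<and> is_diagram D' \<and>
     (planar_isotopic D D' \<or> (\<exists>T T'. moves T T' \<and> local_move T T' D D'))"

definition same_link :: "diagram \<Rightarrow> diagram \<Rightarrow> bool" where
  "same_link = equivclp elementary_move"


section \<open>States and the bracket\<close>

type_synonym ratfun = "rat poly poly fract"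

definition ind_a :: ratfun where
  "ind_a = Fract [:[:0, 1:]:] 1"

definition ind_b :: ratfun where
  "ind_b = Fract [:0, 1:] 1"

text \<open>
  The three terms of the skein relations: the virtual crossing, the oriented smoothing and the
  other planar smoothing.
\<close>

datatype resolution = Vv | Oo | Uu

definition skein_coeff :: "bool \<Rightarrow> resolution \<Rightarrow> ratfun" where
  "skein_coeff is_pos R =
     (let \<delta> = ind_b\<^sup>2 - ind_a\<^sup>2 in
      if is_pos then (case R of Vv \<Rightarrow> ind_a | Oo \<Rightarrow> ind_b | Uu \<Rightarrow> ind_b)
      else (case R of Vv \<Rightarrow> - (ind_a / \<delta>) | Oo \<Rightarrow> ind_b / \<delta> | Uu \<Rightarrow> ind_b / \<delta>))"

text \<open>
  A state of \<open>D\<close> assigns a resolution to every classical crossing, indexed by its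
  over-passage.  Its circles are obtained by cutting the circles of \<open>D\<close> at both
  passages of every classical crossing and gluing the resulting ends according to the resolution.
  The circles of the state pass straight through virtual crossings.

  \<open>arc_rel\<close> relates two points if they lie on a common arc that avoids the cut points.
  \<open>end_in D p\<close> is the set of points on the arc arriving at the cut point \<open>p\<close>, and
  \<open>end_out D p\<close> that of the points on the arc leaving from it.
\<close>

definition cuts :: "diagram \<Rightarrow> point set" where
  "cuts D = over D \<union> partner D ` over D"

definition arc_rel :: "diagram \<Rightarrow> point rel" where
  "arc_rel D = {((i, frac x), (i, frac y)) | i x y.
     i < length (curves D) \<and> x \<le> y \<and> (\<forall>z\<in>{x..y}. (i, frac z) \<notin> cuts D)}"

definition end_in :: "diagram \<Rightarrow> point \<Rightarrow> point set" where
  "end_in D p = {(fst p, frac x) | x. x < snd p \<and> (\<forall>z\<in>{x..<snd p}. (fst p, frac z) \<notin> cuts D)}"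

definition end_out :: "diagram \<Rightarrow> point \<Rightarrow> point set" where
  "end_out D p = {(fst p, frac x) | x. snd p < x \<and> (\<forall>z\<in>{snd p<..x}. (fst p, frac z) \<notin> cuts D)}"

definition glue_rel :: "diagram \<Rightarrow> resolution \<Rightarrow> point \<Rightarrow> point \<Rightarrow> point rel" where
  "glue_rel D R p q =
     (case R of
        Vv \<Rightarrow> end_in D p \<times> end_out D p \<union> end_in D q \<times> end_out D q
      | Oo \<Rightarrow> end_in D p \<times> end_out D q \<union> end_in D q \<times> end_out D p
      | Uu \<Rightarrow> end_in D p \<times> end_in D q \<union> end_out D p \<times> end_out D q)"

definition state_rel :: "diagram \<Rightarrow> (point \<Rightarrow> resolution) \<Rightarrow> point rel" where
  "state_rel D \<sigma> =
     (let G = arc_rel D \<union> (\<Union>p\<in>over D. glue_rel D (\<sigma> p) p (partner D p)) in (G \<union> G\<inverse>)\<^sup>*)"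

definition state_circles :: "diagram \<Rightarrow> (point \<Rightarrow> resolution) \<Rightarrow> nat" where
  "state_circles D \<sigma> = card ((points D - cuts D) // state_rel D \<sigma>)"

definition state_virtuals :: "diagram \<Rightarrow> (point \<Rightarrow> resolution) \<Rightarrow> nat" where
  "state_virtuals D \<sigma> = virtual_writhe D + card {p \<in> over D. \<sigma> p = Vv}"

definition state_value :: "ratfun \<Rightarrow> ratfun \<Rightarrow> diagram \<Rightarrow> (point \<Rightarrow> resolution) \<Rightarrow> ratfun" where
  "state_value r s D \<sigma> =
     r ^ state_virtuals D \<sigma> * s ^ card (wens D) * (- 2) ^ state_circles D \<sigma>"

definition bracket :: "ratfun \<Rightarrow> ratfun \<Rightarrow> diagram \<Rightarrow> ratfun" where
  "bracket r s D =
     (\<Sum>\<sigma>\<in>over D \<rightarrow>\<^sub>E UNIV.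
        (\<Prod>p\<in>over D. skein_coeff (positive D p) (\<sigma> p)) * state_value r s D \<sigma>)"

definition Y :: "ratfun \<Rightarrow> ratfun \<Rightarrow> diagram \<Rightarrow> ratfun" where
  "Y r s D = r ^ virtual_writhe D * (ind_a * r - ind_b) powi (- writhe D) * bracket r s D"

end

theory Submission
  imports Defs
begin

text \<open>
  With loop value -2, the three terms of the skein relation satisfy the binor identity: the
  values of the states that differ only by a virtual crossing, an oriented smoothing and the other
  smoothing at one crossing add up to 0, as one of the three has one circle more than the other
  two.  Modulo this identity a positive crossing is \<open>a r - b\<close> times a virtual one (after
  absorbing the factor \<open>r\<close> of a virtual crossing), and a negative crossing is its inverse
  times a virtual one.  The normalized bracket thus only sees the state in which all crossings are
  virtual: it is \<open>(-2)\<close> to the number of components times \<open>s\<close> to the number of wens.  No move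
  changes the number of components or the parity of the number of wens.
\<close>

section \<open>Equivalence closures and their number of classes\<close>

text \<open>The circles of a state are classes of an equivalence relation on uncountably many
  points, so comparing their numbers takes an argument about generators. Resolve all crossings but
  one. Besides closed circles, two paths should remain, whose four ends lie at that crossing, and
  the three resolutions are the three perfect matchings of these ends. The matching that agrees with
  the paths closes each of them separately; the other two make one circle out of both. With n
  circles in the latter case, the sum is (-2)^(n+1) + 2 (-2)^n = 0. That exactly two paths remain is
  the real obstacle. It follows from the invariant \<open>paired\<close>: it holds for the arcs
  between cut points and survives joining two free ends, hence resolving crossings one by one. The
  identity applies to the skein relation because both smoothings have the same coefficient: their
  sum is minus the virtual term. The inverse for a negative crossing comes from the factorization
  b^2 - a^2 = (a r - b)(- a r - b), valid since r^2 = 1.\<close>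

definition eqcl :: "'a rel \<Rightarrow> 'a rel" where
  "eqcl P = (P \<union> P\<inverse>)\<^sup>*"

lemma eqcl_refl [simp]: "(x, x) \<in> eqcl P"
  by (simp add: eqcl_def)

lemma eqcl_sym: "(x, y) \<in> eqcl P \<Longrightarrow> (y, x) \<in> eqcl P"
  unfolding eqcl_def by (meson sym_Un_converse sym_rtrancl symD)

lemma eqcl_trans: "(x, y) \<in> eqcl P \<Longrightarrow> (y, z) \<in> eqcl P \<Longrightarrow> (x, z) \<in> eqcl P"
  unfolding eqcl_def by (rule rtrancl_trans)

lemma eqcl_base: "(x, y) \<in> P \<Longrightarrow> (x, y) \<in> eqcl P"
  unfolding eqcl_def by auto

lemma eqcl_least: "P \<subseteq> eqcl Q \<Longrightarrow> eqcl P \<subseteq> eqcl Q"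
proof -
  assume *: "P \<subseteq> eqcl Q"
  have "P \<union> P\<inverse> \<subseteq> eqcl Q" using * eqcl_sym by fastforce
  then have "(P \<union> P\<inverse>)\<^sup>* \<subseteq> (eqcl Q)\<^sup>*" by (rule rtrancl_mono)
  then show ?thesis unfolding eqcl_def by simp
qed

lemma eqcl_mono: "P \<subseteq> Q \<Longrightarrow> eqcl P \<subseteq> eqcl Q"
  by (rule eqcl_least) (auto intro: eqcl_base)

text \<open>A property that no generator changes is constant along a chain. This is how classes are
  bounded from outside.\<close>

lemma eqcl_invariant:
  assumes "(x, y) \<in> eqcl P" and "Q x" and "\<And>u v. (u, v) \<in> P \<Longrightarrow> Q u \<longleftrightarrow> Q v"
  shows "Q y"
  using assms(1) unfolding eqcl_def
  by (induction rule: rtrancl_induct) (use assms in auto)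

text \<open>A chain that uses the new pair several times can be shortened to one that uses it at
  most once, in one of the two directions.\<close>

lemma eqcl_insert_iff:
  "(u, v) \<in> eqcl (insert (x, y) P) \<longleftrightarrow>
     (u, v) \<in> eqcl P \<or> (u, x) \<in> eqcl P \<and> (y, v) \<in> eqcl P \<or> (u, y) \<in> eqcl P \<and> (x, v) \<in> eqcl P"
    (is "_ \<longleftrightarrow> ?R v")
proof
  assume "(u, v) \<in> eqcl (insert (x, y) P)"
  then show "?R v"
  proof (rule eqcl_invariant)
    fix p q assume "(p, q) \<in> insert (x, y) P"
    then consider "p = x" "q = y" | "(p, q) \<in> eqcl P" "(q, p) \<in> eqcl P"
      by (auto intro: eqcl_base eqcl_sym)
    then show "?R p \<longleftrightarrow> ?R q"
      by cases (auto, (meson eqcl_trans eqcl_sym eqcl_refl)+)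
  qed simp
next
  have "(x, y) \<in> eqcl (insert (x, y) P)" "(y, x) \<in> eqcl (insert (x, y) P)"
    by (auto intro: eqcl_base eqcl_sym)
  moreover have "eqcl P \<subseteq> eqcl (insert (x, y) P)" by (rule eqcl_mono) auto
  moreover assume "?R v"
  ultimately show "(u, v) \<in> eqcl (insert (x, y) P)" by (meson eqcl_trans subsetD)
qed

lemma eqcl_insert_absorb: "(x, y) \<in> eqcl P \<Longrightarrow> eqcl (insert (x, y) P) = eqcl P"
  by (intro subset_antisym eqcl_least eqcl_mono) (auto intro: eqcl_base)

lemma eqcl_class_eq_iff: "eqcl P `` {x} = eqcl P `` {y} \<longleftrightarrow> (x, y) \<in> eqcl P"
  by (auto intro: eqcl_sym eqcl_trans)

text \<open>The classes of \<open>x\<close> and \<open>y\<close> merge. If they already coincide,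
  the formula removes the class and puts it back, so it covers both cases.\<close>

lemma eqcl_quotient_insert:
  assumes "x \<in> X" "y \<in> X"
  shows "X // eqcl (insert (x, y) P) =
    insert (eqcl P `` {x} \<union> eqcl P `` {y}) (X // eqcl P - {eqcl P `` {x}, eqcl P `` {y}})"
proof -
  have 1: "eqcl (insert (x, y) P) `` {u} = eqcl P `` {x} \<union> eqcl P `` {y}"
    if "(x, u) \<in> eqcl P \<or> (y, u) \<in> eqcl P" for u
  proof -
    have "(u, v) \<in> eqcl (insert (x, y) P) \<longleftrightarrow> (x, v) \<in> eqcl P \<or> (y, v) \<in> eqcl P" for v
      using that unfolding eqcl_insert_iff by (meson eqcl_sym eqcl_trans)
    then show ?thesis by auto
  qed
  have 2: "eqcl (insert (x, y) P) `` {u} = eqcl P `` {u}"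
    if "(x, u) \<notin> eqcl P" "(y, u) \<notin> eqcl P" for u
    using that by (auto simp: eqcl_insert_iff intro: eqcl_sym eqcl_trans)
  have "X // eqcl (insert (x, y) P) = (\<lambda>u. eqcl (insert (x, y) P) `` {u}) ` X" by (auto simp: quotient_def)
  also have "\<dots> = insert (eqcl P `` {x} \<union> eqcl P `` {y})
      ((\<lambda>u. eqcl P `` {u}) ` {u \<in> X. (x, u) \<notin> eqcl P \<and> (y, u) \<notin> eqcl P})" (is "_ = ?m")
  proof (intro equalityI subsetI)
    fix C assume "C \<in> (\<lambda>u. eqcl (insert (x, y) P) `` {u}) ` X"
    then obtain u where "u \<in> X" "C = eqcl (insert (x, y) P) `` {u}" by auto
    then show "C \<in> ?m" using 1[of u] 2[of u] by blast
  next
    fix C assume "C \<in> ?m"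
    then consider "C = eqcl (insert (x, y) P) `` {x}"
      | u where "u \<in> X" "C = eqcl (insert (x, y) P) `` {u}"
      using 1[of x] 2 by auto
    then show "C \<in> (\<lambda>u. eqcl (insert (x, y) P) `` {u}) ` X" using assms by cases auto
  qed
  also have "((\<lambda>u. eqcl P `` {u}) ` {u \<in> X. (x, u) \<notin> eqcl P \<and> (y, u) \<notin> eqcl P})
      = X // eqcl P - {eqcl P `` {x}, eqcl P `` {y}}"
  proof -
    have "(z, u) \<notin> eqcl P \<longleftrightarrow> eqcl P `` {u} \<noteq> eqcl P `` {z}" for z u
      unfolding eqcl_class_eq_iff using eqcl_sym by metis
    moreover have "X // eqcl P = (\<lambda>u. eqcl P `` {u}) ` X" by (auto simp: quotient_def)
    ultimately show ?thesis by (simp only:) blast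
  qed
  finally show ?thesis .
qed

lemma finite_quotient_insert_iff:
  "x \<in> X \<Longrightarrow> y \<in> X \<Longrightarrow> finite (X // eqcl (insert (x, y) P)) \<longleftrightarrow> finite (X // eqcl P)"
  by (simp add: eqcl_quotient_insert)

text \<open>Two classes leave and one enters; the union is not an old class, since it would make
  \<open>x\<close> and \<open>y\<close> equivalent before.\<close>

lemma card_quotient_insert:
  assumes "x \<in> X" "y \<in> X" "(x, y) \<notin> eqcl P" "finite (X // eqcl P)"
  shows "card (X // eqcl P) = Suc (card (X // eqcl (insert (x, y) P)))"
proof -
  have ne: "eqcl P `` {x} \<noteq> eqcl P `` {y}" using assms(3) by (simp add: eqcl_class_eq_iff)
  have sub: "{eqcl P `` {x}, eqcl P `` {y}} \<subseteq> X // eqcl P"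
    using assms(1,2) by (auto intro: quotientI)
  have new: "eqcl P `` {x} \<union> eqcl P `` {y} \<notin> X // eqcl P"
  proof
    assume "eqcl P `` {x} \<union> eqcl P `` {y} \<in> X // eqcl P"
    then obtain u where u: "eqcl P `` {x} \<union> eqcl P `` {y} = eqcl P `` {u}"
      by (auto simp: quotient_def)
    have "x \<in> eqcl P `` {u}" "y \<in> eqcl P `` {u}" unfolding u[symmetric] by auto
    then show False using assms(3) by (auto intro: eqcl_sym eqcl_trans)
  qed
  \<comment> \<open>Keeps the truncated subtraction of 2 exact when the two old classes are
    removed.\<close>
  have "2 \<le> card (X // eqcl P)"
    using card_mono[OF assms(4) sub] ne by simp
  then show ?thesis
    using new ne sub assms by (simp add: eqcl_quotient_insert card_Diff_subset)
qed


section \<open>Gluing ends\<close>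

text \<open>
  The situation of the free ends of a collection of paths.
\<close>

definition paired :: "'a rel \<Rightarrow> ('e \<Rightarrow> 'a) \<Rightarrow> 'e set \<Rightarrow> bool" where
  "paired R f S \<longleftrightarrow>
     (\<exists>m. \<forall>e\<in>S. m e \<in> S \<and> m e \<noteq> e \<and> (\<forall>e'\<in>S. (f e, f e') \<in> R \<longleftrightarrow> e' = e \<or> e' = m e))"

text \<open>Symmetry of the closure makes the matching an involution.\<close>

lemma pairedE:
  assumes "paired (eqcl P) f S"
  obtains m where "\<forall>e\<in>S. m e \<in> S \<and> m e \<noteq> e \<and> m (m e) = e \<and>
      (\<forall>e'\<in>S. (f e, f e') \<in> eqcl P \<longleftrightarrow> e' = e \<or> e' = m e)"
proof -
  obtain m where m: "\<forall>e\<in>S. m e \<in> S \<and> m e \<noteq> e \<and>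
      (\<forall>e'\<in>S. (f e, f e') \<in> eqcl P \<longleftrightarrow> e' = e \<or> e' = m e)"
    using assms unfolding paired_def by (rule exE)
  have "m (m e) = e" if "e \<in> S" for e
    using m that eqcl_sym[of "f e" "f (m e)" P] by metis
  with m show ?thesis by (intro that[of m]) blast
qed

text \<open>Joining ends of two different paths gives one longer path, whose ends are the two
  remaining ones. Joining both ends of one path closes it up and leaves all other paths
  alone.\<close>

lemma paired_glue:
  assumes "paired (eqcl P) f S" "e1 \<in> S" "e2 \<in> S" "e1 \<noteq> e2"
  shows "paired (eqcl (insert (f e1, f e2) P)) f (S - {e1, e2})"
proof -
  obtain m where m_all: "\<forall>e\<in>S. m e \<in> S \<and> m e \<noteq> e \<and> m (m e) = e \<and>
      (\<forall>e'\<in>S. (f e, f e') \<in> eqcl P \<longleftrightarrow> e' = e \<or> e' = m e)"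
    by (rule pairedE[OF assms(1)])
  then have m: "m e \<in> S" "m e \<noteq> e" and mm: "m (m e) = e" if "e \<in> S" for e
    using that by blast+
  have rel: "(f e, f e') \<in> eqcl P \<longleftrightarrow> e' = e \<or> e' = m e" if "e \<in> S" "e' \<in> S" for e e'
    using m_all that by blast
  have inj: "m e = m e' \<Longrightarrow> e = e'" if "e \<in> S" "e' \<in> S" for e e'
    using mm that by metis
  \<comment> \<open>The former mates of \<open>e1\<close> and \<open>e2\<close> become mates of each
    other. If \<open>e1\<close> and \<open>e2\<close> were mates, neither special case occurs
    outside of \<open>{e1, e2}\<close>.\<close>
  define n where "n e = (if m e = e1 then m e2 else if m e = e2 then m e1 else m e)" for e
  show ?thesis
    unfolding paired_def
  proof (intro exI[of _ n] ballI)
    fix e assume e: "e \<in> S - {e1, e2}"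
    have eS: "e \<in> S" "e \<noteq> e1" "e \<noteq> e2" using e by auto
    show "n e \<in> S - {e1, e2} \<and> n e \<noteq> e \<and> (\<forall>e'\<in>S - {e1, e2}.
        (f e, f e') \<in> eqcl (insert (f e1, f e2) P) \<longleftrightarrow> e' = e \<or> e' = n e)"
    proof (cases "m e = e1 \<or> m e = e2")
      case True
      then consider "m e = e1" "m e1 = e" | "m e = e2" "m e2 = e" using mm[OF eS(1)] by auto
      then show ?thesis
      proof cases
        case 1
        then have "m e2 \<noteq> e1" "m e2 \<noteq> e2" "m e2 \<noteq> e" "n e = m e2"
          using eS assms(2-4) m mm[of e2] inj[of e2 e1] by (auto simp: n_def)
        then show ?thesis
          using 1 eS assms(2-4) m by (auto simp: eqcl_insert_iff rel)
      next
        case 2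
        then have "m e1 \<noteq> e1" "m e1 \<noteq> e2" "m e1 \<noteq> e" "n e = m e1"
          using eS assms(2-4) m mm[of e1] inj[of e2 e1] by (auto simp: n_def)
        then show ?thesis
          using 2 eS assms(2-4) m by (auto simp: eqcl_insert_iff rel)
      qed
    next
      case False
      then show ?thesis
        using eS assms(2-4) m by (auto simp: eqcl_insert_iff rel n_def)
    qed
  qed
qed

text \<open>Here \<open>a\<close>, \<open>b\<close> belong to one path and \<open>c\<close>,
  \<open>d\<close> to another. Joining \<open>a\<close> to \<open>b\<close> and \<open>c\<close> to
  \<open>d\<close> relates nothing new. In the two other gluings one pair merges the classes of both
  paths, after which the other pair is redundant.\<close>

lemma card_quotient_three_gluings:
  assumes X: "a \<in> X" "b \<in> X" "c \<in> X" "d \<in> X" and fin: "finite (X // eqcl P)"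
    and ab: "(a, b) \<in> eqcl P" and cd: "(c, d) \<in> eqcl P" and ac: "(a, c) \<notin> eqcl P"
  shows "card (X // eqcl (insert (a, b) (insert (c, d) P))) = card (X // eqcl P)"
    and "card (X // eqcl P) = Suc (card (X // eqcl (insert (a, c) (insert (b, d) P))))"
    and "card (X // eqcl P) = Suc (card (X // eqcl (insert (a, d) (insert (b, c) P))))"
proof -
  have "eqcl (insert (a, b) (insert (c, d) P)) = eqcl (insert (c, d) P)"
    using ab by (intro eqcl_insert_absorb) (simp add: eqcl_insert_iff)
  then show "card (X // eqcl (insert (a, b) (insert (c, d) P))) = card (X // eqcl P)"
    using cd by (simp add: eqcl_insert_absorb)
  have "(b, d) \<notin> eqcl P" "(b, c) \<notin> eqcl P" using ab cd ac by (meson eqcl_sym eqcl_trans)+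
  note less = card_quotient_insert[OF X(2,4) this(1) fin] card_quotient_insert[OF X(2,3) this(2) fin]
  have "(a, c) \<in> eqcl (insert (b, d) P)" "(a, d) \<in> eqcl (insert (b, c) P)"
    using ab cd by (auto simp: eqcl_insert_iff intro: eqcl_sym)
  note this[THEN eqcl_insert_absorb]
  then show
    "card (X // eqcl P) = Suc (card (X // eqcl (insert (a, c) (insert (b, d) P))))"
    "card (X // eqcl P) = Suc (card (X // eqcl (insert (a, d) (insert (b, c) P))))"
    using less by presburger+
qed

lemma eqcl_insert_flip: "eqcl (insert (x, y) P) = eqcl (insert (y, x) P)"
  by (auto simp: eqcl_insert_iff)

text \<open>The gluing that joins ends of the same path gives one class more than the other two.\<close>

lemma binor_identity:
  fixes f :: "'e \<Rightarrow> 'a" and X :: "'a set"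
  defines "N \<equiv> \<lambda>P. (- 2 :: 'b::comm_ring_1) ^ card (X // eqcl P)"
  assumes paired: "paired (eqcl P) f {e1, e2, e3, e4}" and dist: "distinct [e1, e2, e3, e4]"
    and X: "f e1 \<in> X" "f e2 \<in> X" "f e3 \<in> X" "f e4 \<in> X" and fin: "finite (X // eqcl P)"
  shows "N (insert (f e1, f e2) (insert (f e3, f e4) P)) +
         N (insert (f e1, f e4) (insert (f e3, f e2) P)) +
         N (insert (f e1, f e3) (insert (f e2, f e4) P)) = 0"
proof -
  let ?a = "f e1" and ?b = "f e2" and ?c = "f e3" and ?d = "f e4"
  have flip: "eqcl (insert p (insert (x, y) P)) = eqcl (insert p (insert (y, x) P))" for p x y
    using eqcl_insert_flip[of x y "insert p P"] by (simp add: insert_commute)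
  let ?S = "{e1, e2, e3, e4}"
  obtain m where m_all: "\<forall>e\<in>?S. m e \<in> ?S \<and> m e \<noteq> e \<and> m (m e) = e \<and>
      (\<forall>e'\<in>?S. (f e, f e') \<in> eqcl P \<longleftrightarrow> e' = e \<or> e' = m e)"
    by (rule pairedE[OF paired])
  have m: "m e \<in> ?S" "m e \<noteq> e" and mm: "m (m e) = e" if "e \<in> ?S" for e
    using m_all[rule_format, OF that] by auto
  have rel: "(f e, f e') \<in> eqcl P \<longleftrightarrow> e' = e \<or> e' = m e" if "e \<in> ?S" "e' \<in> ?S" for e e'
    using bspec[OF m_all that(1), THEN conjunct2, THEN conjunct2, THEN conjunct2] that(2)
    by (rule bspec)
  have "m e1 \<noteq> e1" "m e1 \<in> ?S" using m[of e1] by simp_all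
  \<comment> \<open>The mate of \<open>e1\<close> determines the matching of all four ends, and
    thereby which of the three gluings has the extra class.\<close>
  then consider "m e1 = e2" | "m e1 = e3" | "m e1 = e4" by blast
  then show ?thesis
  proof cases
    case 1
    then have "m e3 \<noteq> e1" "m e3 \<noteq> e2" using mm[of e3] mm[of e1] dist by auto
    then have "m e3 = e4" using m[of e3] by auto
    then have "(?a, ?b) \<in> eqcl P" "(?c, ?d) \<in> eqcl P" "(?a, ?c) \<notin> eqcl P"
      using 1 rel[of e1 e2] rel[of e3 e4] rel[of e1 e3] dist by auto
    from card_quotient_three_gluings[OF X fin this]
    show ?thesis unfolding N_def by (simp add: flip[of _ ?c ?b])
  next
    case 2
    then have "m e2 \<noteq> e1" "m e2 \<noteq> e3" using mm[of e2] mm[of e1] dist by auto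
    then have "m e2 = e4" using m[of e2] by auto
    then have "(?a, ?c) \<in> eqcl P" "(?b, ?d) \<in> eqcl P" "(?a, ?b) \<notin> eqcl P"
      using 2 rel[of e1 e3] rel[of e2 e4] rel[of e1 e2] dist by auto
    from card_quotient_three_gluings[OF X(1,3,2,4) fin this]
    show ?thesis unfolding N_def by simp
  next
    case 3
    then have "m e3 \<noteq> e1" "m e3 \<noteq> e4" using mm[of e3] mm[of e1] dist by auto
    then have "m e3 = e2" using m[of e3] by auto
    then have "(?a, ?d) \<in> eqcl P" "(?c, ?b) \<in> eqcl P" "(?a, ?c) \<notin> eqcl P"
      using 3 rel[of e1 e4] rel[of e3 e2] rel[of e1 e3] dist by auto
    from card_quotient_three_gluings[OF X(1,4,3,2) fin this]
    show ?thesis unfolding N_def by (simp add: flip[of _ ?d ?b] flip[of _ ?d ?c])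
  qed
qed


section \<open>Arcs of a diagram\<close>

text \<open>Meant for the lift \<open>L\<close> to the real line of finitely many points of a
  circle. If \<open>z\<close> represents the only such point, the next one is \<open>z + 1\<close>:
  the gap goes once around the circle.\<close>

lemma periodic_gap_right:
  fixes L :: "real set"
  assumes fin: "finite (L \<inter> {z..z + 1})" and per: "\<And>w n. w \<in> L \<Longrightarrow> w + of_int n \<in> L"
  shows "\<exists>w>z. {z<..<w} \<inter> L = {} \<and> (L \<noteq> {} \<longrightarrow> w \<in> L)"
proof (cases "L = {}")
  case False
  then obtain w0 where "w0 \<in> L" by auto
  \<comment> \<open>The integer translate of \<open>w0\<close> that falls into
    \<open>{z<..z + 1}\<close>.\<close>
  then have "w0 + of_int (\<lfloor>z - w0\<rfloor> + 1) \<in> L" by (rule per)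
  moreover have "z < w0 + of_int (\<lfloor>z - w0\<rfloor> + 1)" "w0 + of_int (\<lfloor>z - w0\<rfloor> + 1) \<le> z + 1"
    by linarith+
  ultimately have ne: "L \<inter> {z<..z + 1} \<noteq> {}" by (metis IntI empty_iff greaterThanAtMost_iff)
  have fin': "finite (L \<inter> {z<..z + 1})" by (rule finite_subset[OF _ fin]) auto
  define w where "w = Min (L \<inter> {z<..z + 1})"
  have w: "w \<in> L" "z < w" "w \<le> z + 1" using Min_in[OF fin' ne] by (auto simp: w_def)
  have "w \<le> v" if "v \<in> L" "z < v" "v \<le> z + 1" for v
    unfolding w_def using fin' that by (intro Min_le) auto
  then show ?thesis using w by (intro exI[of _ w]) force
qed (auto intro: exI[of _ "z + 1"])

text \<open>Reflection of the line reduces this to the gap on the right.\<close>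

lemma periodic_gap_left:
  fixes L :: "real set"
  assumes fin: "finite (L \<inter> {z - 1..z})" and per: "\<And>w n. w \<in> L \<Longrightarrow> w + of_int n \<in> L"
  shows "\<exists>w<z. {w<..<z} \<inter> L = {} \<and> (L \<noteq> {} \<longrightarrow> w \<in> L)"
proof -
  have "uminus ` L \<inter> {- z..- z + 1} \<subseteq> uminus ` (L \<inter> {z - 1..z})" by auto
  then have 1: "finite (uminus ` L \<inter> {- z..- z + 1})" using fin finite_surj by blast
  have 2: "w + of_int n \<in> uminus ` L" if "w \<in> uminus ` L" for w n
    using per[of "- w" "- n"] that by (auto simp: image_iff intro!: bexI[of _ "- w + of_int (- n)"])
  obtain w where w: "w > - z" "{- z<..<w} \<inter> uminus ` L = {}" "uminus ` L \<noteq> {} \<longrightarrow> w \<in> uminus ` L"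
    using periodic_gap_right[OF 1 2] by auto
  have "{- w<..<z} \<inter> L = {}"
  proof (rule ccontr)
    assume "{- w<..<z} \<inter> L \<noteq> {}"
    then obtain v where "v \<in> L" "- w < v" "v < z" by auto
    then have "- v \<in> {- z<..<w} \<inter> uminus ` L" by auto
    then show False using w(2) by auto
  qed
  then show ?thesis using w by (intro exI[of _ "- w"]) auto
qed

section \<open>Parameters on the circle and their lifts to the line\<close>

lemma frac_eq_iff_Ints: "frac x = frac y \<longleftrightarrow> x - y \<in> \<int>" for x y :: real
proof
  assume "frac x = frac y"
  then have "x - y = of_int (\<lfloor>x\<rfloor> - \<lfloor>y\<rfloor>)" by (simp add: frac_def)
  then show "x - y \<in> \<int>" by (metis Ints_of_int)
next
  assume "x - y \<in> \<int>"
  then obtain n where "x = y + of_int n" by (metis Ints_cases diff_add_cancel add.commute)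
  then show "frac x = frac y" by (simp add: frac_def)
qed

lemma frac_eq_obtain:
  fixes x y :: real
  assumes "frac x = frac y" obtains n where "x = y + of_int n"
  using assms unfolding frac_eq_iff_Ints by (metis Ints_cases diff_add_cancel add.commute)

lemma frac_add_of_int [simp]: "frac (x + of_int n) = frac x" for x :: real
  by (simp add: frac_def)

text \<open>An integer shift replaces the representative in \<open>{0..<1}\<close> by an arbitrary
  lift \<open>z\<close>. This takes care of arcs that run through parameter 0.\<close>

lemma end_in_frac:
  "end_in D (i, frac z) = {(i, frac x) | x. x < z \<and> (\<forall>w\<in>{x..<z}. (i, frac w) \<notin> cuts D)}"
proof -
  have z: "z = frac z + of_int \<lfloor>z\<rfloor>" by (simp add: frac_def)
  have "(\<exists>x. u = (i, frac x) \<and> x < frac z \<and> (\<forall>w\<in>{x..<frac z}. (i, frac w) \<notin> cuts D)) \<longleftrightarrow>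
     (\<exists>x. u = (i, frac x) \<and> x < z \<and> (\<forall>w\<in>{x..<z}. (i, frac w) \<notin> cuts D))" (is "?l \<longleftrightarrow> ?r") for u
  proof
    assume ?l
    then obtain x where x: "u = (i, frac x)" "x < frac z"
      "\<forall>w\<in>{x..<frac z}. (i, frac w) \<notin> cuts D" by auto
    have "(i, frac w) \<notin> cuts D" if "w \<in> {x + of_int \<lfloor>z\<rfloor>..<z}" for w
      using x(3)[rule_format, of "w + of_int (- \<lfloor>z\<rfloor>)"] that z
      unfolding frac_add_of_int by auto
    then show ?r using x z by (intro exI[of _ "x + of_int \<lfloor>z\<rfloor>"]) auto
  next
    assume ?r
    then obtain x where x: "u = (i, frac x)" "x < z"
      "\<forall>w\<in>{x..<z}. (i, frac w) \<notin> cuts D" by auto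
    have "(i, frac w) \<notin> cuts D" if "w \<in> {x + of_int (- \<lfloor>z\<rfloor>)..<frac z}" for w
      using x(3)[rule_format, of "w + of_int \<lfloor>z\<rfloor>"] that z
      unfolding frac_add_of_int by auto
    then show ?l using x z
      by (intro exI[of _ "x + of_int (- \<lfloor>z\<rfloor>)"]) (simp only: frac_add_of_int, auto)
  qed
  then show ?thesis unfolding end_in_def by auto
qed

lemma end_out_frac:
  "end_out D (i, frac z) = {(i, frac x) | x. z < x \<and> (\<forall>w\<in>{z<..x}. (i, frac w) \<notin> cuts D)}"
proof -
  have z: "z = frac z + of_int \<lfloor>z\<rfloor>" by (simp add: frac_def)
  have "(\<exists>x. u = (i, frac x) \<and> frac z < x \<and> (\<forall>w\<in>{frac z<..x}. (i, frac w) \<notin> cuts D)) \<longleftrightarrow>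
     (\<exists>x. u = (i, frac x) \<and> z < x \<and> (\<forall>w\<in>{z<..x}. (i, frac w) \<notin> cuts D))" (is "?l \<longleftrightarrow> ?r") for u
  proof
    assume ?l
    then obtain x where x: "u = (i, frac x)" "frac z < x"
      "\<forall>w\<in>{frac z<..x}. (i, frac w) \<notin> cuts D" by auto
    have "(i, frac w) \<notin> cuts D" if "w \<in> {z<..x + of_int \<lfloor>z\<rfloor>}" for w
      using x(3)[rule_format, of "w + of_int (- \<lfloor>z\<rfloor>)"] that z
      unfolding frac_add_of_int by auto
    then show ?r using x z by (intro exI[of _ "x + of_int \<lfloor>z\<rfloor>"]) auto
  next
    assume ?r
    then obtain x where x: "u = (i, frac x)" "z < x"
      "\<forall>w\<in>{z<..x}. (i, frac w) \<notin> cuts D" by auto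
    have "(i, frac w) \<notin> cuts D" if "w \<in> {frac z<..x + of_int (- \<lfloor>z\<rfloor>)}" for w
      using x(3)[rule_format, of "w + of_int \<lfloor>z\<rfloor>"] that z
      unfolding frac_add_of_int by auto
    then show ?l using x z
      by (intro exI[of _ "x + of_int (- \<lfloor>z\<rfloor>)"]) (simp only: frac_add_of_int, auto)
  qed
  then show ?thesis unfolding end_out_def by auto
qed

lemma finite_lifts:
  assumes "finite C"
  shows "finite ({z. (i, frac z) \<in> C} \<inter> {x..y :: real})"
proof (rule finite_subset)
  show "{z. (i, frac z) \<in> C} \<inter> {x..y} \<subseteq> (\<lambda>(p, n). snd p + of_int n) ` (C \<times> {\<lfloor>x\<rfloor>..\<lfloor>y\<rfloor>})"
  proof
    fix z assume z: "z \<in> {z. (i, frac z) \<in> C} \<inter> {x..y}"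
    then have "\<lfloor>x\<rfloor> \<le> \<lfloor>z\<rfloor>" "\<lfloor>z\<rfloor> \<le> \<lfloor>y\<rfloor>" by (auto intro: floor_mono)
    then show "z \<in> (\<lambda>(p, n). snd p + of_int n) ` (C \<times> {\<lfloor>x\<rfloor>..\<lfloor>y\<rfloor>})"
      using z by (intro image_eqI[of _ _ "((i, frac z), \<lfloor>z\<rfloor>)"]) (auto simp: frac_def)
  qed
qed (use assms in auto)

lemma gap_right:
  assumes "finite (cuts D)"
  obtains w where "z < w" "\<forall>v\<in>{z<..<w}. (i, frac v) \<notin> cuts D"
    "(i, frac z) \<in> cuts D \<Longrightarrow> (i, frac w) \<in> cuts D"
  using periodic_gap_right[of "{z. (i, frac z) \<in> cuts D}" z, OF finite_lifts[OF assms]] by fastforce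

lemma gap_left:
  assumes "finite (cuts D)"
  obtains w where "w < z" "\<forall>v\<in>{w<..<z}. (i, frac v) \<notin> cuts D"
    "(i, frac z) \<in> cuts D \<Longrightarrow> (i, frac w) \<in> cuts D"
  using periodic_gap_left[of "{z. (i, frac z) \<in> cuts D}" z, OF finite_lifts[OF assms]] by fastforce

section \<open>Crossings and cut points of a fixed diagram\<close>

locale link_diagram =
  fixes D :: diagram
  assumes diagram: "is_diagram D"
begin

abbreviation free_points :: "point set" where "free_points \<equiv> points D - cuts D"

lemma double_pair_sym: "double_pair D p q \<Longrightarrow> double_pair D q p"
  by (auto simp: double_pair_def)

lemma double_pair_unique: "double_pair D p q \<Longrightarrow> double_pair D p q' \<Longrightarrow> q = q'"
  using diagram unfolding is_diagram_def by (elim conjE) metis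

lemma partner_eqI: "double_pair D p q \<Longrightarrow> partner D p = q"
  unfolding partner_def by (rule the_equality) (simp_all add: double_pair_unique)

lemma over_subset_passages: "over D \<subseteq> passages D"
  using diagram by (simp add: is_diagram_def)

lemma double_pair_partner:
  assumes "p \<in> over D"
  shows "double_pair D p (partner D p)"
proof -
  obtain q where "double_pair D p q"
    using assms over_subset_passages unfolding passages_def by blast
  then show ?thesis using partner_eqI[of p q] by simp
qed

lemma partner_partner: "p \<in> over D \<Longrightarrow> partner D (partner D p) = p"
  using double_pair_partner double_pair_sym partner_eqI by blast

lemma partner_not_over: "p \<in> over D \<Longrightarrow> partner D p \<notin> over D"
  using diagram by (auto simp: is_diagram_def)

lemma partner_neq: "p \<in> over D \<Longrightarrow> partner D p \<noteq> p"
  using partner_not_over by metis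

lemma inj_on_partner: "inj_on (partner D) (over D)"
  by (metis inj_onI partner_partner)

lemma cuts_subset_points: "cuts D \<subseteq> points D"
  using double_pair_partner by (auto simp: double_pair_def cuts_def)

lemma finite_over: "finite (over D)"
  using diagram over_subset_passages by (auto simp: is_diagram_def intro: finite_subset)

lemma finite_cuts: "finite (cuts D)"
  by (simp add: cuts_def finite_over)

lemma points_cases:
  assumes "p \<in> points D"
  obtains i z where "p = (i, frac z)" "i < length (curves D)"
proof -
  obtain i t where "p = (i, t)" "i < length (curves D)" "t \<in> {0..<1}"
    using assms by (auto simp: points_def)
  moreover from this have "t = frac t" by (simp add: frac_eq)
  ultimately show ?thesis using that by metis
qed

lemma frac_in_points [simp]: "(i, frac z) \<in> points D \<longleftrightarrow> i < length (curves D)"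
  by (auto simp: points_def frac_lt_1)

section \<open>Ends of arcs at the cut points\<close>

text \<open>An end is a cut point together with the side, \<open>True\<close> for the arriving arc.\<close>

definition end_set :: "point \<times> bool \<Rightarrow> point set" where
  "end_set e = (if snd e then end_in D (fst e) else end_out D (fst e))"

text \<open>One representative stands for the whole end. The two ends of an arc are the same set of
  points and get the same representative; hence ends are kept as labels, and \<open>paired\<close>
  has the map \<open>f\<close> from labels to points.\<close>

definition end_pt :: "point \<times> bool \<Rightarrow> point" where
  "end_pt e = (SOME x. x \<in> end_set e)"

lemma end_set_nonempty:
  assumes "p \<in> points D"
  shows "end_set (p, b) \<noteq> {}"
proof -
  obtain i z where p: "p = (i, frac z)" using assms by (rule points_cases)
  show ?thesis
  proof (cases b)
    case True
    obtain w where "w < z" "\<forall>v\<in>{w<..<z}. (i, frac v) \<notin> cuts D"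
      using gap_left[OF finite_cuts] by metis
    then have "(w + z) / 2 < z" "\<forall>v\<in>{(w + z) / 2..<z}. (i, frac v) \<notin> cuts D" by auto
    then have "(i, frac ((w + z) / 2)) \<in> end_in D (i, frac z)" unfolding end_in_frac by blast
    then show ?thesis using True p by (auto simp: end_set_def)
  next
    case False
    obtain w where "z < w" "\<forall>v\<in>{z<..<w}. (i, frac v) \<notin> cuts D"
      using gap_right[OF finite_cuts] by metis
    then have "z < (z + w) / 2" "\<forall>v\<in>{z<..(z + w) / 2}. (i, frac v) \<notin> cuts D" by auto
    then have "(i, frac ((z + w) / 2)) \<in> end_out D (i, frac z)" unfolding end_out_frac by blast
    then show ?thesis using False p by (auto simp: end_set_def)
  qed
qed

lemma end_pt_in: "p \<in> points D \<Longrightarrow> end_pt (p, b) \<in> end_set (p, b)"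
  unfolding end_pt_def some_in_eq by (rule end_set_nonempty)

lemma end_set_subset:
  assumes "p \<in> points D"
  shows "end_set (p, b) \<subseteq> free_points"
proof -
  obtain i z where "p = (i, frac z)" "i < length (curves D)" using assms by (rule points_cases)
  then show ?thesis by (cases b) (auto simp: end_set_def end_in_frac end_out_frac)
qed

lemma end_pt_in_free_points: "p \<in> points D \<Longrightarrow> end_pt (p, b) \<in> free_points"
  using end_pt_in end_set_subset by blast

lemma arc_rel_frac:
  assumes "x \<le> y" "\<forall>z\<in>{x..y}. (i, frac z) \<notin> cuts D" "i < length (curves D)"
  shows "((i, frac x), (i, frac y)) \<in> arc_rel D"
  unfolding arc_rel_def by (rule CollectI, intro exI conjI, rule refl) (use assms in auto)

text \<open>The interval between two points of an end lies in the cut-free interval from the farther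
  one to the cut point.\<close>

lemma end_set_connected:
  assumes "p \<in> points D" "u \<in> end_set (p, b)" "v \<in> end_set (p, b)"
  shows "(u, v) \<in> eqcl (arc_rel D)"
proof -
  obtain i z where p: "p = (i, frac z)" "i < length (curves D)" using assms(1) by (rule points_cases)
  have le: "((i, frac x), (i, frac y)) \<in> eqcl (arc_rel D)"
    if "x \<le> y" "\<forall>z\<in>{x..y}. (i, frac z) \<notin> cuts D" for x y
    using that p(2) by (intro eqcl_base arc_rel_frac)
  show ?thesis
  proof (cases b)
    case True
    obtain x where x: "u = (i, frac x)" "x < z" "\<forall>w\<in>{x..<z}. (i, frac w) \<notin> cuts D"
      using assms(2) True p by (auto simp: end_set_def end_in_frac)
    obtain y where y: "v = (i, frac y)" "y < z" "\<forall>w\<in>{y..<z}. (i, frac w) \<notin> cuts D"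
      using assms(3) True p by (auto simp: end_set_def end_in_frac)
    show ?thesis
      using le[of x y] le[of y x] x y by (cases "x \<le> y") (auto intro: eqcl_sym)
  next
    case False
    obtain x where x: "u = (i, frac x)" "z < x" "\<forall>w\<in>{z<..x}. (i, frac w) \<notin> cuts D"
      using assms(2) False p by (auto simp: end_set_def end_out_frac)
    obtain y where y: "v = (i, frac y)" "z < y" "\<forall>w\<in>{z<..y}. (i, frac w) \<notin> cuts D"
      using assms(3) False p by (auto simp: end_set_def end_out_frac)
    show ?thesis
      using le[of x y] le[of y x] x y by (cases "x \<le> y") (auto intro: eqcl_sym)
  qed
qed

text \<open>A generator of \<open>arc_rel\<close> joins two points through an interval without cut
  points, which cannot jump over a lift of \<open>p\<close>. So the end is a union of
  classes.\<close>

lemma end_set_closed: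
  assumes p: "p \<in> cuts D" and u: "u \<in> end_set (p, b)" and uv: "(u, v) \<in> eqcl (arc_rel D)"
  shows "v \<in> end_set (p, b)"
  using uv u
proof (rule eqcl_invariant)
  fix u v assume "(u, v) \<in> arc_rel D"
  then obtain j x y where uv: "u = (j, frac x)" "v = (j, frac y)" "x \<le> y"
    and free: "\<forall>w\<in>{x..y}. (j, frac w) \<notin> cuts D"
    by (auto simp: arc_rel_def)
  obtain i z where pz: "p = (i, frac z)"
    using p cuts_subset_points points_cases by blast
  have cut: "(i, frac (z + of_int n)) \<in> cuts D" for n using p pz by simp
  show "u \<in> end_set (p, b) \<longleftrightarrow> v \<in> end_set (p, b)"
  proof (cases b)
    case True
    show ?thesis
    proof
      assume "u \<in> end_set (p, b)"
      then obtain x' where x': "j = i" "frac x = frac x'" "x' < z"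
        "\<forall>w\<in>{x'..<z}. (i, frac w) \<notin> cuts D"
        using True pz uv by (auto simp: end_set_def end_in_frac)
      obtain n where n: "x = x' + of_int n" using x'(2) by (rule frac_eq_obtain)
      \<comment> \<open>Otherwise the lift \<open>z + of_int n\<close> of \<open>p\<close> would lie
        in the cut-free interval from \<open>x\<close> to \<open>y\<close>.\<close>
      have "y < z + of_int n"
        using bspec[OF free, of "z + of_int n"] cut[of n] x'(1,3) n by fastforce
      moreover have "\<forall>w\<in>{y..<z + of_int n}. (i, frac w) \<notin> cuts D"
      proof
        fix w assume "w \<in> {y..<z + of_int n}"
        then have "w + of_int (- n) \<in> {x'..<z}" using n uv(3) by auto
        then show "(i, frac w) \<notin> cuts D" using x'(4) frac_add_of_int by metis
      qed
      ultimately have "(i, frac y) \<in> end_in D (i, frac (z + of_int n))"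
        unfolding end_in_frac by blast
      then show "v \<in> end_set (p, b)" using True pz uv x'(1) by (simp add: end_set_def)
    next
      assume "v \<in> end_set (p, b)"
      then obtain y' where y': "j = i" "frac y = frac y'" "y' < z"
        "\<forall>w\<in>{y'..<z}. (i, frac w) \<notin> cuts D"
        using True pz uv by (auto simp: end_set_def end_in_frac)
      obtain n where n: "y = y' + of_int n" using y'(2) by (rule frac_eq_obtain)
      have "\<forall>w\<in>{x..<z + of_int n}. (i, frac w) \<notin> cuts D"
      proof
        fix w assume w: "w \<in> {x..<z + of_int n}"
        show "(i, frac w) \<notin> cuts D"
        proof (cases "w \<le> y")
          case False
          then have "w + of_int (- n) \<in> {y'..<z}" using n w by auto
          then show "(i, frac w) \<notin> cuts D" using y'(4) frac_add_of_int by metis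
        qed (use free w y'(1) in auto)
      qed
      moreover have "x < z + of_int n" using n uv(3) y'(3) by auto
      ultimately have "(i, frac x) \<in> end_in D (i, frac (z + of_int n))"
        unfolding end_in_frac by blast
      then show "u \<in> end_set (p, b)" using True pz uv y'(1) by (simp add: end_set_def)
    qed
  next
    case False
    show ?thesis
    proof
      assume "v \<in> end_set (p, b)"
      then obtain y' where y': "j = i" "frac y = frac y'" "z < y'"
        "\<forall>w\<in>{z<..y'}. (i, frac w) \<notin> cuts D"
        using False pz uv by (auto simp: end_set_def end_out_frac)
      obtain n where n: "y = y' + of_int n" using y'(2) by (rule frac_eq_obtain)
      have "z + of_int n < x"
        using bspec[OF free, of "z + of_int n"] cut[of n] y'(1,3) n by fastforce
      moreover have "\<forall>w\<in>{z + of_int n<..x}. (i, frac w) \<notin> cuts D"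
      proof
        fix w assume "w \<in> {z + of_int n<..x}"
        then have "w + of_int (- n) \<in> {z<..y'}" using n uv(3) by auto
        then show "(i, frac w) \<notin> cuts D" using y'(4) frac_add_of_int by metis
      qed
      ultimately have "(i, frac x) \<in> end_out D (i, frac (z + of_int n))"
        unfolding end_out_frac by blast
      then show "u \<in> end_set (p, b)" using False pz uv y'(1) by (simp add: end_set_def)
    next
      assume "u \<in> end_set (p, b)"
      then obtain x' where x': "j = i" "frac x = frac x'" "z < x'"
        "\<forall>w\<in>{z<..x'}. (i, frac w) \<notin> cuts D"
        using False pz uv by (auto simp: end_set_def end_out_frac)
      obtain n where n: "x = x' + of_int n" using x'(2) by (rule frac_eq_obtain)
      have "\<forall>w\<in>{z + of_int n<..y}. (i, frac w) \<notin> cuts D"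
      proof
        fix w assume w: "w \<in> {z + of_int n<..y}"
        show "(i, frac w) \<notin> cuts D"
        proof (cases "x \<le> w")
          case False
          then have "w + of_int (- n) \<in> {z<..x'}" using n w by auto
          then show "(i, frac w) \<notin> cuts D" using x'(4) frac_add_of_int by metis
        qed (use free w x'(1) in auto)
      qed
      moreover have "z + of_int n < y" using n uv(3) x'(3) by auto
      ultimately have "(i, frac y) \<in> end_out D (i, frac (z + of_int n))"
        unfolding end_out_frac by blast
      then show "v \<in> end_set (p, b)" using False pz uv x'(1) by (simp add: end_set_def)
    qed
  qed
qed

text \<open>The cut point of an end is the first one met when going from \<open>u\<close> in the
  direction given by \<open>b\<close>.\<close>

lemma end_set_inj:
  assumes p: "p \<in> cuts D" "p' \<in> cuts D" and u: "u \<in> end_set (p, b)" "u \<in> end_set (p', b)"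
  shows "p' = p"
proof -
  obtain i z where pz: "p = (i, frac z)"
    using p(1) cuts_subset_points points_cases by blast
  obtain i' z' where pz': "p' = (i', frac z')"
    using p(2) cuts_subset_points points_cases by blast
  have cut: "(i, frac (z + of_int n)) \<in> cuts D" for n using p pz by simp
  show ?thesis
  proof (cases b)
    case True
    obtain x where x: "u = (i, frac x)" "x < z" "\<forall>w\<in>{x..<z}. (i, frac w) \<notin> cuts D"
      using u(1) True pz by (auto simp: end_set_def end_in_frac)
    obtain x' where x': "i' = i" "frac x' = frac x" "x' < z'" "\<forall>w\<in>{x'..<z'}. (i, frac w) \<notin> cuts D"
      using u(2) True pz' x(1) by (auto simp: end_set_def end_in_frac)
    obtain n where n: "x' = x + of_int n" using x'(2) by (rule frac_eq_obtain)
    have "\<not> z + of_int n < z'"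
      using bspec[OF x'(4), of "z + of_int n"] cut[of n] x(2) n by fastforce
    moreover have "\<not> z' + of_int (- n) < z"
    proof
      assume "z' + of_int (- n) < z"
      moreover have "x \<le> z' + of_int (- n)" using x'(3) n by simp
      ultimately have "(i, frac (z' + of_int (- n))) \<notin> cuts D" using x(3) by simp
      then show False using p(2) pz' x'(1) unfolding frac_add_of_int by simp
    qed
    ultimately have "z' = z + of_int n" by simp
    then show ?thesis using pz pz' x'(1) by simp
  next
    case False
    obtain x where x: "u = (i, frac x)" "z < x" "\<forall>w\<in>{z<..x}. (i, frac w) \<notin> cuts D"
      using u(1) False pz by (auto simp: end_set_def end_out_frac)
    obtain x' where x': "i' = i" "frac x' = frac x" "z' < x'" "\<forall>w\<in>{z'<..x'}. (i, frac w) \<notin> cuts D"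
      using u(2) False pz' x(1) by (auto simp: end_set_def end_out_frac)
    obtain n where n: "x' = x + of_int n" using x'(2) by (rule frac_eq_obtain)
    have "\<not> z' < z + of_int n"
      using bspec[OF x'(4), of "z + of_int n"] cut[of n] x(2) n by fastforce
    moreover have "\<not> z < z' + of_int (- n)"
    proof
      assume "z < z' + of_int (- n)"
      moreover have "z' + of_int (- n) \<le> x" using x'(3) n by simp
      ultimately have "(i, frac (z' + of_int (- n))) \<notin> cuts D" using x(3) by simp
      then show False using p(2) pz' x'(1) unfolding frac_add_of_int by simp
    qed
    ultimately have "z' = z + of_int n" by simp
    then show ?thesis using pz pz' x'(1) by simp
  qed
qed

text \<open>The arc at this end has another end, at the neighbouring cut point; its midpoint lies in
  both. On a component with a single cut point, \<open>p'\<close> is \<open>p\<close>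
  itself.\<close>

lemma end_set_meets:
  assumes "p \<in> cuts D"
  obtains p' u where "p' \<in> cuts D" "u \<in> end_set (p, b)" "u \<in> end_set (p', \<not> b)"
proof -
  obtain i z where pz: "p = (i, frac z)"
    using assms cuts_subset_points points_cases by blast
  show ?thesis
  proof (cases b)
    case True
    obtain w where w: "w < z" "\<forall>v\<in>{w<..<z}. (i, frac v) \<notin> cuts D" "(i, frac w) \<in> cuts D"
      using gap_left[OF finite_cuts, of z i] assms pz by metis
    have "\<forall>v\<in>{(w + z) / 2..<z}. (i, frac v) \<notin> cuts D" "\<forall>v\<in>{w<..(w + z) / 2}. (i, frac v) \<notin> cuts D"
      using w by auto
    then have "(i, frac ((w + z) / 2)) \<in> end_in D (i, frac z)"
      "(i, frac ((w + z) / 2)) \<in> end_out D (i, frac w)"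
      using w(1) unfolding end_in_frac end_out_frac by auto
    then show ?thesis using that w(3) True pz by (auto simp: end_set_def)
  next
    case False
    obtain w where w: "z < w" "\<forall>v\<in>{z<..<w}. (i, frac v) \<notin> cuts D" "(i, frac w) \<in> cuts D"
      using gap_right[OF finite_cuts, of z i] assms pz by metis
    have "\<forall>v\<in>{(w + z) / 2..<w}. (i, frac v) \<notin> cuts D" "\<forall>v\<in>{z<..(w + z) / 2}. (i, frac v) \<notin> cuts D"
      using w by auto
    then have "(i, frac ((w + z) / 2)) \<in> end_out D (i, frac z)"
      "(i, frac ((w + z) / 2)) \<in> end_in D (i, frac w)"
      using w(1) unfolding end_in_frac end_out_frac by auto
    then show ?thesis using that w(3) False pz by (auto simp: end_set_def)
  qed
qed

text \<open>Each arc between cut points leaves from one and arrives at one, so the mate of an end is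
  the opposite-sided end at the neighbouring cut point. Ends on the same side are related only if
  their cut points agree.\<close>

lemma paired_arcs: "paired (eqcl (arc_rel D)) end_pt (cuts D \<times> UNIV)"
proof -
  have "\<exists>p'\<in>cuts D. \<exists>u. u \<in> end_set (p, b) \<and> u \<in> end_set (p', \<not> b)" if "p \<in> cuts D" for p b
    using end_set_meets[OF that] by metis
  then obtain m where m: "\<And>p b. p \<in> cuts D \<Longrightarrow> m p b \<in> cuts D"
    "\<And>p b. p \<in> cuts D \<Longrightarrow> \<exists>u. u \<in> end_set (p, b) \<and> u \<in> end_set (m p b, \<not> b)" by metis
  have same: "(end_pt (p, b), end_pt (p', b)) \<in> eqcl (arc_rel D) \<longleftrightarrow> p' = p"
    if "p \<in> cuts D" "p' \<in> cuts D" for p p' b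
  proof
    assume "(end_pt (p, b), end_pt (p', b)) \<in> eqcl (arc_rel D)"
    then have "end_pt (p', b) \<in> end_set (p, b)"
      using end_set_closed that cuts_subset_points end_pt_in by blast
    then show "p' = p" using end_set_inj end_pt_in cuts_subset_points that by blast
  qed simp
  have across: "(end_pt (p, b), end_pt (m p b, \<not> b)) \<in> eqcl (arc_rel D)" if p: "p \<in> cuts D" for p b
  proof -
    obtain u where "u \<in> end_set (p, b)" "u \<in> end_set (m p b, \<not> b)" using m(2)[OF p] by metis
    then show ?thesis
      using end_set_connected end_pt_in cuts_subset_points p m(1)[OF p]
      by (meson eqcl_trans subsetD)
  qed
  have "(end_pt (p, b), end_pt (p', \<not> b)) \<in> eqcl (arc_rel D) \<longleftrightarrow> p' = m p b"
    if "p \<in> cuts D" "p' \<in> cuts D" for p p' b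
    using across[OF that(1)] same[OF m(1)[OF that(1)] that(2)] eqcl_trans eqcl_sym by metis
  then have "(end_pt (p, b), end_pt (p', b')) \<in> eqcl (arc_rel D) \<longleftrightarrow>
      (p', b') = (p, b) \<or> (p', b') = (m p b, \<not> b)" if "p \<in> cuts D" "p' \<in> cuts D" for p p' b b'
    using that same by (cases "b' = b") auto
  then show ?thesis
    unfolding paired_def using m(1) by (intro exI[of _ "\<lambda>(p, b). (m p b, \<not> b)"]) auto
qed


section \<open>States\<close>

definition glued_ends :: "resolution \<Rightarrow> point \<Rightarrow> point \<Rightarrow> (point \<times> bool) rel" where
  "glued_ends R p q = (case R of
      Vv \<Rightarrow> {((p, True), (p, False)), ((q, True), (q, False))}
    | Oo \<Rightarrow> {((p, True), (q, False)), ((q, True), (p, False))}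
    | Uu \<Rightarrow> {((p, True), (q, True)), ((p, False), (q, False))})"

text \<open>Two pairs of representatives in place of the products of point sets in
  \<open>glue_rel\<close>: a state then arises from the arcs by finitely many insertions, each with
  a known effect on the number of classes.\<close>

definition gluings :: "resolution \<Rightarrow> point \<Rightarrow> point rel" where
  "gluings R p = map_prod end_pt end_pt ` glued_ends R p (partner D p)"

lemma glue_rel_end_set: "glue_rel D R p q = (\<Union>(e, e')\<in>glued_ends R p q. end_set e \<times> end_set e')"
  by (cases R) (simp_all add: glue_rel_def glued_ends_def end_set_def)

lemma glued_ends_over:
  assumes "p \<in> over D" "(e, e') \<in> glued_ends R p (partner D p)"
  shows "fst e \<in> points D" "fst e' \<in> points D"
proof -
  have "p \<in> points D" "partner D p \<in> points D"
    using assms cuts_subset_points by (auto simp: cuts_def)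
  then show "fst e \<in> points D" "fst e' \<in> points D"
    using assms(2) by (auto simp: glued_ends_def split: resolution.splits)
qed

text \<open>All points of an end are already related along their arc, so a single pair generates the
  product of two ends.\<close>

lemma state_rel_eq_gluings:
  "state_rel D \<sigma> = eqcl (arc_rel D \<union> (\<Union>p\<in>over D. gluings (\<sigma> p) p))" (is "_ = eqcl ?P")
proof -
  let ?G = "arc_rel D \<union> (\<Union>p\<in>over D. glue_rel D (\<sigma> p) p (partner D p))"
  have mem: "end_pt e \<in> end_set e" if "fst e \<in> points D" for e
    using end_pt_in[OF that, of "snd e"] by simp
  have "gluings (\<sigma> p) p \<subseteq> glue_rel D (\<sigma> p) p (partner D p)" if p: "p \<in> over D" for p
  proof
    fix x assume "x \<in> gluings (\<sigma> p) p"
    then obtain e e' where "x = (end_pt e, end_pt e')"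
      and e: "(e, e') \<in> glued_ends (\<sigma> p) p (partner D p)"
      unfolding gluings_def by auto
    then have "x \<in> end_set e \<times> end_set e'"
      using mem glued_ends_over[OF p e] by simp
    then show "x \<in> glue_rel D (\<sigma> p) p (partner D p)"
      using e unfolding glue_rel_end_set by blast
  qed
  then have "?P \<subseteq> ?G" by blast
  moreover have "glue_rel D (\<sigma> p) p (partner D p) \<subseteq> eqcl ?P" if p: "p \<in> over D" for p
  proof
    fix x assume "x \<in> glue_rel D (\<sigma> p) p (partner D p)"
    then obtain e e' u v where x: "x = (u, v)" "u \<in> end_set e" "v \<in> end_set e'"
      and e: "(e, e') \<in> glued_ends (\<sigma> p) p (partner D p)"
      unfolding glue_rel_end_set by auto
    note pts = glued_ends_over[OF p e]
    have "eqcl (arc_rel D) \<subseteq> eqcl ?P" by (rule eqcl_mono) auto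
    moreover have "(u, end_pt e) \<in> eqcl (arc_rel D)" "(end_pt e', v) \<in> eqcl (arc_rel D)"
      using end_set_connected[of "fst e" _ "snd e"] end_set_connected[of "fst e'" _ "snd e'"]
        pts mem x by simp_all
    moreover have "(end_pt e, end_pt e') \<in> ?P"
      using e p unfolding gluings_def by force
    then have "(end_pt e, end_pt e') \<in> eqcl ?P" by (rule eqcl_base)
    ultimately show "x \<in> eqcl ?P" unfolding x(1) by (meson eqcl_trans subsetD)
  qed
  then have "(\<Union>p\<in>over D. glue_rel D (\<sigma> p) p (partner D p)) \<subseteq> eqcl ?P" by (rule UN_least)
  then have "?G \<subseteq> eqcl ?P" by (auto simp del: UN_subset_iff intro: eqcl_base)
  ultimately have "eqcl ?P \<subseteq> eqcl ?G" "eqcl ?G \<subseteq> eqcl ?P"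
    by (simp_all only: eqcl_mono eqcl_least)
  then have "eqcl ?G = eqcl ?P" by (rule subset_antisym[rotated])
  then show ?thesis by (simp add: state_rel_def eqcl_def Let_def)
qed

text \<open>Every resolution joins the four ends at a crossing in two disjoint pairs, so
  \<open>paired_glue\<close> applies twice.\<close>

lemma paired_gluings:
  assumes paired: "paired (eqcl P) end_pt S" and p: "p \<in> over D"
    and S: "{p, partner D p} \<times> UNIV \<subseteq> S"
  shows "paired (eqcl (gluings R p \<union> P)) end_pt (S - {p, partner D p} \<times> UNIV)"
proof -
  define q where "q = partner D p"
  have pq: "p \<noteq> q" using partner_neq[OF p] by (simp add: q_def)
  have two: "paired (eqcl ({(end_pt e1, end_pt e2), (end_pt e3, end_pt e4)} \<union> P)) end_pt
      (S - {p, q} \<times> UNIV)"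
    if "distinct [e1, e2, e3, e4]" "{p, q} \<times> UNIV = {e3, e4, e1, e2}" for e1 e2 e3 e4
  proof -
    have "{e3, e4, e1, e2} \<subseteq> S" using S unfolding q_def[symmetric] that(2) .
    then have "paired (eqcl (insert (end_pt e3, end_pt e4) P)) end_pt (S - {e3, e4})"
      using that(1) by (intro paired_glue paired) auto
    from paired_glue[OF this, of e1 e2]
    have "paired (eqcl (insert (end_pt e1, end_pt e2) (insert (end_pt e3, end_pt e4) P))) end_pt
        (S - {e3, e4} - {e1, e2})"
      using that(1) \<open>{e3, e4, e1, e2} \<subseteq> S\<close> by auto
    moreover have "S - {e3, e4} - {e1, e2} = S - {p, q} \<times> UNIV" unfolding that(2) by auto
    ultimately show ?thesis by simp
  qed
  have "paired (eqcl ({(end_pt (p, True), end_pt (p, False)),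
      (end_pt (q, True), end_pt (q, False))} \<union> P)) end_pt (S - {p, q} \<times> UNIV)"
    "paired (eqcl ({(end_pt (p, True), end_pt (q, False)),
      (end_pt (q, True), end_pt (p, False))} \<union> P)) end_pt (S - {p, q} \<times> UNIV)"
    "paired (eqcl ({(end_pt (p, True), end_pt (q, True)),
      (end_pt (p, False), end_pt (q, False))} \<union> P)) end_pt (S - {p, q} \<times> UNIV)"
    by (rule two; use pq in \<open>auto simp: UNIV_bool\<close>)+
  then show ?thesis
    by (cases R) (simp_all add: gluings_def glued_ends_def flip: q_def)
qed

text \<open>Only the crossings in \<open>F\<close> are resolved; the free ends are those at the
  other crossings. The case that matters is all crossings but one.\<close>

lemma paired_partial_state:
  assumes "finite F" "F \<subseteq> over D"
  shows "paired (eqcl ((\<Union>p\<in>F. gluings (\<sigma> p) p) \<union> arc_rel D)) end_pt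
    ((cuts D - (F \<union> partner D ` F)) \<times> UNIV)"
  using assms
proof (induction F rule: finite_induct)
  case empty
  show ?case using paired_arcs by simp
next
  case (insert p F)
  have pF: "p \<in> over D" "F \<subseteq> over D" using insert.prems by auto
  have "p \<notin> partner D ` F" using pF partner_not_over by auto
  moreover have "partner D p \<notin> F" using partner_not_over[OF pF(1)] pF(2) by blast
  moreover have "partner D p \<notin> partner D ` F"
    using pF insert.hyps(2) inj_on_partner by (auto dest: inj_onD)
  ultimately have "{p, partner D p} \<times> UNIV \<subseteq> (cuts D - (F \<union> partner D ` F)) \<times> UNIV"
    using insert.hyps(2) pF unfolding cuts_def by blast
  from paired_gluings[OF insert.IH[OF pF(2)] pF(1) this, of "\<sigma> p"]
  moreover have "(cuts D - (F \<union> partner D ` F)) \<times> UNIV - {p, partner D p} \<times> UNIV =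
      (cuts D - (insert p F \<union> partner D ` insert p F)) \<times> (UNIV :: bool set)"
    by auto
  ultimately show ?case by (simp only: UN_insert Un_assoc)
qed

section \<open>Counting the circles of a state\<close>

lemma end_pt_over_in_free_points: "p \<in> over D \<Longrightarrow> end_pt (p, b) \<in> free_points" "p \<in> over D \<Longrightarrow> end_pt (partner D p, b) \<in> free_points"
  by (rule end_pt_in_free_points, use cuts_subset_points in \<open>force simp: cuts_def\<close>)+

lemma gluings_subset_free_points: "p \<in> over D \<Longrightarrow> gluings R p \<subseteq> free_points \<times> free_points"
  using end_pt_over_in_free_points by (cases R) (simp_all add: gluings_def glued_ends_def)

lemma finite_gluings: "finite (gluings R p)"
  by (cases R) (simp_all add: gluings_def glued_ends_def)

text \<open>Walk from \<open>x\<close> to \<open>y\<close> along the component: at each cut point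
  the virtual resolution leads straight on. The induction is on the number of cut points still
  ahead.\<close>

lemma virtual_state_same_component:
  assumes Vv: "\<forall>p\<in>over D. \<sigma> p = Vv" and i: "i < length (curves D)"
    and "x \<le> y" "(i, frac x) \<notin> cuts D" "(i, frac y) \<notin> cuts D"
  shows "((i, frac x), (i, frac y)) \<in> state_rel D \<sigma>"
  using assms(3,4)
proof (induction "card ({z. (i, frac z) \<in> cuts D} \<inter> {x..y})" arbitrary: x rule: less_induct)
  case less
  let ?L = "\<lambda>x. {z. (i, frac z) \<in> cuts D} \<inter> {x..y}"
  have fin: "finite (?L x)" for x by (rule finite_lifts[OF finite_cuts])
  have arcs: "eqcl (arc_rel D) \<subseteq> state_rel D \<sigma>"
    unfolding state_rel_eq_gluings by (rule eqcl_mono) auto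
  show ?case
  proof (cases "?L x = {}")
    case True
    then have "((i, frac x), (i, frac y)) \<in> arc_rel D"
      using less.prems i by (intro arc_rel_frac) auto
    then show ?thesis by (intro subsetD[OF arcs] eqcl_base)
  next
    case False
    define z where "z = Min (?L x)"
    have z: "z \<in> ?L x" unfolding z_def by (rule Min_in[OF fin False])
    have first: "z \<le> w" if "w \<in> ?L x" for w unfolding z_def using that fin by (intro Min_le)
    have xz: "x < z" using z less.prems(2) by (cases "x = z") auto
    have zy: "z < y" using z assms(5) by (cases "z = y") auto
    obtain w where w: "z < w" "\<forall>v\<in>{z<..<w}. (i, frac v) \<notin> cuts D"
      using gap_right[OF finite_cuts] by metis
    \<comment> \<open>A point just behind the first cut point \<open>z\<close>, before the next cut
      point and before \<open>y\<close>.\<close>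
    define u where "u = (z + min w y) / 2"
    have u: "z < u" "u < w" "u < y" using w(1) zy by (auto simp: u_def min_def)
    have free: "\<forall>v\<in>{z<..u}. (i, frac v) \<notin> cuts D" using w u by auto
    let ?p = "(i, frac z)"
    have p: "?p \<in> cuts D" using z by simp
    have "\<forall>v\<in>{x..<z}. (i, frac v) \<notin> cuts D" using first zy by fastforce
    then have x_in: "(i, frac x) \<in> end_in D ?p" using xz unfolding end_in_frac by blast
    have u_out: "(i, frac u) \<in> end_out D ?p" using u free unfolding end_out_frac by blast
    \<comment> \<open>The cut may be the over- or the under-passage; \<open>Vv\<close> continues
      both straight.\<close>
    obtain p where "p \<in> over D" "?p = p \<or> ?p = partner D p" using p by (auto simp: cuts_def)
    then have "((i, frac x), (i, frac u)) \<in> glue_rel D (\<sigma> p) p (partner D p)"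
      using Vv x_in u_out by (auto simp: glue_rel_def)
    then have "((i, frac x), (i, frac u)) \<in> state_rel D \<sigma>"
      using \<open>p \<in> over D\<close> unfolding state_rel_def Let_def by blast
    moreover have "((i, frac u), (i, frac y)) \<in> state_rel D \<sigma>"
    proof (rule less.hyps)
      have "z \<in> ?L x - ?L u" using z u by simp
      moreover have "?L u \<subseteq> ?L x" using u xz by auto
      ultimately have "?L u \<subset> ?L x" by blast
      then show "card (?L u) < card (?L x)" by (intro psubset_card_mono fin)
    qed (use u free in auto)
    ultimately show ?thesis unfolding state_rel_eq_gluings by (rule eqcl_trans)
  qed
qed

text \<open>With all crossings virtual, no generator changes the component index; conversely,
  walking along a component never gets stuck.\<close>

lemma virtual_state_rel_iff:
  assumes Vv: "\<forall>p\<in>over D. \<sigma> p = Vv" and uv: "u \<in> free_points" "v \<in> free_points"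
  shows "(u, v) \<in> state_rel D \<sigma> \<longleftrightarrow> fst u = fst v"
proof
  assume "(u, v) \<in> state_rel D \<sigma>"
  then have "fst v = fst u"
    unfolding state_rel_def Let_def eqcl_def[symmetric]
  proof (rule eqcl_invariant)
    fix x y assume "(x, y) \<in> arc_rel D \<union> (\<Union>p\<in>over D. glue_rel D (\<sigma> p) p (partner D p))"
    then have "fst x = fst y"
      using Vv by (auto simp: arc_rel_def glue_rel_def end_in_def end_out_def)
    then show "fst x = fst u \<longleftrightarrow> fst y = fst u" by simp
  qed simp
  then show "fst u = fst v" by simp
next
  assume eq: "fst u = fst v"
  obtain i x where u: "u = (i, frac x)" "i < length (curves D)" using uv points_cases by blast
  obtain y where v: "v = (i, frac y)" using uv points_cases eq u by (metis DiffD1 fst_conv)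
  show "(u, v) \<in> state_rel D \<sigma>"
    using virtual_state_same_component[OF Vv u(2), of x y]
      virtual_state_same_component[OF Vv u(2), of y x] u v uv
    by (cases "x \<le> y") (auto simp: state_rel_eq_gluings intro: eqcl_sym)
qed

lemma virtual_state_circles:
  assumes Vv: "\<forall>p\<in>over D. \<sigma> p = Vv"
  shows "finite (free_points // state_rel D \<sigma>)" "state_circles D \<sigma> = length (curves D)"
proof -
  let ?c = "\<lambda>u. state_rel D \<sigma> `` {u}"
  have eq: "?c u = ?c v \<longleftrightarrow> fst u = fst v" if "u \<in> free_points" "v \<in> free_points" for u v
    using virtual_state_rel_iff[OF Vv that] by (simp add: state_rel_eq_gluings eqcl_class_eq_iff)
  have fst_X: "fst ` free_points = {..<length (curves D)}"
  proof
    show "{..<length (curves D)} \<subseteq> fst ` free_points"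
    proof
      fix i assume i: "i \<in> {..<length (curves D)}"
      \<comment> \<open>Finitely many cut points do not exhaust a circle, so every component is
        counted.\<close>
      have "infinite ({0..<1::real} - snd ` cuts D)"
        using finite_cuts by (intro Diff_infinite_finite) (auto simp: infinite_Ico)
      then obtain t where "t \<in> {0..<1::real} - snd ` cuts D" by (metis finite.emptyI ex_in_conv)
      then have "(i, t) \<in> free_points" using i by (force simp: points_def)
      then show "i \<in> fst ` free_points" by force
    qed
  qed (auto simp: points_def)
  define g where "g i = ?c (SOME u. u \<in> free_points \<and> fst u = i)" for i
  have g: "g (fst u) = ?c u" if "u \<in> free_points" for u
  proof -
    have "(SOME v. v \<in> free_points \<and> fst v = fst u) \<in> free_points \<and> fst (SOME v. v \<in> free_points \<and> fst v = fst u) = fst u"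
      using that by (intro someI[of "\<lambda>v. v \<in> free_points \<and> fst v = fst u" u]) simp
    then show ?thesis unfolding g_def using that by (simp add: eq)
  qed
  have "free_points // state_rel D \<sigma> = ?c ` free_points" by (auto simp: quotient_def)
  also have "\<dots> = g ` fst ` free_points" by (simp add: image_image g)
  finally have quot: "free_points // state_rel D \<sigma> = g ` fst ` free_points" .
  have "inj_on g (fst ` free_points)"
  proof (rule inj_onI)
    fix i j assume ij: "i \<in> fst ` free_points" "j \<in> fst ` free_points" "g i = g j"
    then obtain u v where "u \<in> free_points" "i = fst u" "v \<in> free_points" "j = fst v" by blast
    then show "i = j" using ij(3) g eq by metis
  qed
  then show "finite (free_points // state_rel D \<sigma>)" "state_circles D \<sigma> = length (curves D)"
    unfolding state_circles_def quot by (simp_all add: card_image fst_X)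
qed

lemma finite_quotient_Un_iff:
  assumes "finite Q" "Q \<subseteq> free_points \<times> free_points"
  shows "finite (free_points // eqcl (Q \<union> P)) \<longleftrightarrow> finite (free_points // eqcl P)"
  using assms
  by (induction Q rule: finite_induct) (auto simp: finite_quotient_insert_iff)

lemma finite_gluings_over: "finite F \<Longrightarrow> finite (\<Union>p\<in>F. gluings (\<sigma> p) p)"
  by (simp add: finite_gluings)

text \<open>Finiteness is transported backwards: the all-virtual state has finitely many circles and
  arises from the arcs by finitely many gluings, none of which changes whether the quotient is
  finite.\<close>

lemma finite_arcs: "finite (free_points // eqcl (arc_rel D))"
proof -
  have "finite (free_points // state_rel D (\<lambda>_. Vv))" by (rule virtual_state_circles) simp
  then show ?thesis
    using finite_quotient_Un_iff[OF finite_gluings_over[OF finite_over], of "\<lambda>_. Vv" "arc_rel D"]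
      gluings_subset_free_points unfolding state_rel_eq_gluings by (simp add: Un_commute UN_least)
qed

lemma state_circles_binor:
  assumes p: "p \<in> over D"
  shows "(- 2 :: 'b::comm_ring_1) ^ state_circles D (\<sigma>(p := Vv)) +
    (- 2) ^ state_circles D (\<sigma>(p := Oo)) + (- 2) ^ state_circles D (\<sigma>(p := Uu)) = 0"
proof -
  define F where "F = over D - {p}"
  define P where "P = (\<Union>p\<in>F. gluings (\<sigma> p) p) \<union> arc_rel D"
  define q where "q = partner D p"
  have F: "finite F" "F \<subseteq> over D" using finite_over by (auto simp: F_def)
  have pq: "p \<noteq> q" using partner_neq[OF p] by (simp add: q_def)
  have "p \<notin> partner D ` F" using F partner_not_over[of _] p by auto
  moreover have "q \<notin> F" using partner_not_over[OF p] F by (auto simp: q_def)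
  moreover have "q \<notin> partner D ` F"
    using p inj_on_partner unfolding q_def F_def by (auto dest: inj_onD)
  moreover have "cuts D = {p, q} \<union> F \<union> partner D ` F"
    using p unfolding cuts_def F_def q_def by auto
  moreover have "p \<notin> F" by (simp add: F_def)
  ultimately have "(cuts D - (F \<union> partner D ` F)) \<times> (UNIV :: bool set) =
      {(p, True), (p, False), (q, True), (q, False)}"
    by (auto simp: UNIV_bool)
  with paired_partial_state[OF F, of \<sigma>]
  have "paired (eqcl P) end_pt {(p, True), (p, False), (q, True), (q, False)}"
    by (simp add: P_def)
  moreover have "finite (free_points // eqcl P)"
    unfolding P_def using finite_arcs gluings_subset_free_points F
    by (subst finite_quotient_Un_iff[OF finite_gluings_over]) blast+
  moreover have st: "state_rel D (\<sigma>(p := R)) = eqcl (gluings R p \<union> P)" for R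
  proof -
    have "over D = insert p F" using p by (auto simp: F_def)
    moreover have "(\<Union>p'\<in>F. gluings ((\<sigma>(p := R)) p') p') = (\<Union>p'\<in>F. gluings (\<sigma> p') p')"
      by (intro SUP_cong) (auto simp: F_def)
    ultimately show ?thesis
      unfolding state_rel_eq_gluings P_def by (simp add: Un_ac)
  qed
  moreover have "end_pt (p, b) \<in> free_points" "end_pt (q, b) \<in> free_points" for b
    using end_pt_over_in_free_points[OF p] by (simp_all add: q_def)
  ultimately show ?thesis
    \<comment> \<open>In this order of the ends, the three gluings of the identity are
      \<open>Vv\<close>, \<open>Oo\<close> and \<open>Uu\<close>.\<close>
    using binor_identity[of P end_pt "(p, True)" "(p, False)" "(q, True)" "(q, False)" free_points] pq
    unfolding state_circles_def st by (simp add: gluings_def glued_ends_def q_def[symmetric])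
qed

end


section \<open>Evaluation of the normalized bracket\<close>

lemma UNIV_resolution: "(UNIV :: resolution set) = {Vv, Oo, Uu}"
  using resolution.exhaust by blast

text \<open>At each crossing the two smoothings share a coefficient and their values add up to minus
  the virtual value, so the sum over resolutions collapses to one factor times the virtual
  term.\<close>

lemma state_sum_binor:
  fixes c :: "'p \<Rightarrow> resolution \<Rightarrow> 'b::comm_ring_1"
  assumes "finite A" and "\<And>p. p \<in> A \<Longrightarrow> c p Uu = c p Oo"
    and "\<And>\<sigma> p. p \<in> A \<Longrightarrow> f (\<sigma>(p := Vv)) + f (\<sigma>(p := Oo)) + f (\<sigma>(p := Uu)) = 0"
  shows "(\<Sum>\<sigma>\<in>A \<rightarrow>\<^sub>E UNIV. (\<Prod>p\<in>A. c p (\<sigma> p)) * f \<sigma>) =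
    (\<Prod>p\<in>A. c p Vv - c p Oo) * f (restrict (\<lambda>_. Vv) A)"
  using assms
proof (induction A arbitrary: f rule: finite_induct)
  case empty
  then show ?case by (simp add: restrict_def)
next
  case (insert a A)
  let ?P = "\<Prod>p\<in>A. c p Vv - c p Oo" and ?v = "restrict (\<lambda>_. Vv) A"
  have inj: "inj_on (\<lambda>(R, \<sigma>). \<sigma>(a := R)) (UNIV \<times> (A \<rightarrow>\<^sub>E (UNIV :: resolution set)))"
    using inj_combinator[OF insert.hyps(2), of "\<lambda>_. UNIV"] by simp
  have step: "(\<Sum>\<sigma>\<in>A \<rightarrow>\<^sub>E UNIV. (\<Prod>p\<in>insert a A. c p ((\<sigma>(a := R)) p)) * f (\<sigma>(a := R))) =
      c a R * (?P * f (?v(a := R)))" for R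
  proof -
    have "(\<Prod>p\<in>insert a A. c p ((\<sigma>(a := R)) p)) = c a R * (\<Prod>p\<in>A. c p (\<sigma> p))" for \<sigma>
    proof -
      have "(\<Prod>p\<in>A. c p ((\<sigma>(a := R)) p)) = (\<Prod>p\<in>A. c p (\<sigma> p))"
        using insert.hyps(2) by (intro prod.cong) auto
      then show ?thesis using insert.hyps by simp
    qed
    then have "(\<Sum>\<sigma>\<in>A \<rightarrow>\<^sub>E UNIV. (\<Prod>p\<in>insert a A. c p ((\<sigma>(a := R)) p)) * f (\<sigma>(a := R))) =
        c a R * (\<Sum>\<sigma>\<in>A \<rightarrow>\<^sub>E UNIV. (\<Prod>p\<in>A. c p (\<sigma> p)) * f (\<sigma>(a := R)))"
      by (simp add: sum_distrib_left mult.assoc)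
    \<comment> \<open>The induction hypothesis is used for \<open>f\<close> with the resolution at
      \<open>a\<close> frozen to \<open>R\<close>; this function satisfies the three-term identity
      at the crossings in \<open>A\<close>.\<close>
    also have "(\<Sum>\<sigma>\<in>A \<rightarrow>\<^sub>E UNIV. (\<Prod>p\<in>A. c p (\<sigma> p)) * f (\<sigma>(a := R))) = ?P * f (?v(a := R))"
    proof (rule insert.IH)
      fix \<sigma> :: "'p \<Rightarrow> resolution" and p assume p: "p \<in> A"
      have "a \<noteq> p" using p insert.hyps(2) by auto
      show "f (\<sigma>(p := Vv, a := R)) + f (\<sigma>(p := Oo, a := R)) + f (\<sigma>(p := Uu, a := R)) = 0"
        using insert.prems(2)[OF insertI2[OF p], of "\<sigma>(a := R)"]
        unfolding fun_upd_twist[OF \<open>a \<noteq> p\<close>] .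
    qed (use insert.prems in auto)
    finally show ?thesis .
  qed
  have "(\<Sum>\<sigma>\<in>insert a A \<rightarrow>\<^sub>E UNIV. (\<Prod>p\<in>insert a A. c p (\<sigma> p)) * f \<sigma>) =
      (\<Sum>(R, \<sigma>)\<in>UNIV \<times> (A \<rightarrow>\<^sub>E UNIV).
        (\<Prod>p\<in>insert a A. c p ((\<sigma>(a := R)) p)) * f (\<sigma>(a := R)))"
    unfolding PiE_insert_eq sum.reindex[OF inj] by (simp only: comp_def case_prod_unfold)
  also have "\<dots> = (\<Sum>R\<in>UNIV. \<Sum>\<sigma>\<in>A \<rightarrow>\<^sub>E UNIV.
      (\<Prod>p\<in>insert a A. c p ((\<sigma>(a := R)) p)) * f (\<sigma>(a := R)))"
    by (rule sum.cartesian_product[symmetric])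
  also have "\<dots> = (\<Sum>R\<in>UNIV. c a R * (?P * f (?v(a := R))))"
    by (simp only: step)
  also have "\<dots> = ?P * (c a Vv * f (?v(a := Vv)) + c a Oo * (f (?v(a := Oo)) + f (?v(a := Uu))))"
    using insert.prems(1)[of a] by (simp add: UNIV_resolution algebra_simps)
  also have "f (?v(a := Oo)) + f (?v(a := Uu)) = - f (?v(a := Vv))"
    using insert.prems(2)[OF insertI1, of ?v] by (simp only: eq_neg_iff_add_eq_0 add_ac)
  also have "?v(a := Vv) = restrict (\<lambda>_. Vv) (insert a A)" by (auto simp: restrict_def)
  finally show ?case using insert.hyps by (simp add: algebra_simps)
qed

lemma ind_a_b_neq: "ind_a \<noteq> ind_b" "ind_a \<noteq> - ind_b"
  by (simp_all add: ind_a_def ind_b_def eq_fract)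

lemma skein_coeff_diff:
  assumes "r \<in> {1, -1}"
  defines "K \<equiv> ind_a * r - ind_b"
  shows "K \<noteq> 0"
    and "skein_coeff P Vv * r - skein_coeff P Oo = (if P then K else inverse K)"
proof -
  show K: "K \<noteq> 0"
  proof (cases "r = 1")
    case False
    then have "K = - (ind_a + ind_b)" using assms by simp
    then show ?thesis using ind_a_b_neq(2) by (simp add: eq_neg_iff_add_eq_0)
  qed (simp add: K_def ind_a_b_neq)
  have sq: "r\<^sup>2 = 1" using assms by auto
  have "ind_b\<^sup>2 - ind_a\<^sup>2 \<noteq> 0"
    using ind_a_b_neq by (auto simp: power2_eq_iff)
  \<comment> \<open>The second factor is the numerator obtained for a negative crossing, so dividing
    it by the product leaves \<open>inverse K\<close>.\<close>
  moreover have "K * (- (ind_a * r) - ind_b) = ind_b\<^sup>2 - ind_a\<^sup>2"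
    using sq by (simp add: K_def algebra_simps power2_eq_square)
  ultimately have "(- (ind_a * r) - ind_b) / (ind_b\<^sup>2 - ind_a\<^sup>2) = inverse K"
    using K by (simp add: field_simps)
  then show "skein_coeff P Vv * r - skein_coeff P Oo = (if P then K else inverse K)"
    by (simp add: skein_coeff_def Let_def K_def diff_divide_distrib)
qed

theorem Y_eq:
  assumes D: "is_diagram D" and r: "r \<in> {1, -1}"
  shows "Y r s D = s ^ card (wens D) * (- 2) ^ length (curves D)"
proof -
  interpret link_diagram D by unfold_locales (rule D)
  define K where "K = ind_a * r - ind_b"
  \<comment> \<open>The factor \<open>r\<close> of a crossing resolved virtually moves into its
    coefficient, so that the remaining state value depends on the circles alone.\<close>
  define c where "c p R = skein_coeff (positive D p) R * (if R = Vv then r else 1)" for p R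
  let ?v = "virtual_writhe D" and ?m = "card (wens D)" and ?A = "over D \<rightarrow>\<^sub>E (UNIV :: resolution set)"
  have K: "K \<noteq> 0" using skein_coeff_diff(1)[OF r] by (simp add: K_def)
  \<comment> \<open>One factor comes from the virtual crossings in the bracket, the other from the
    normalization.\<close>
  have rv: "r ^ ?v * r ^ ?v = 1" using r by (auto simp flip: power_mult_distrib)
  have rVv: "r ^ card {p \<in> over D. \<sigma> p = Vv} = (\<Prod>p\<in>over D. if \<sigma> p = Vv then r else 1)" for \<sigma>
    using finite_over by (simp add: prod.If_cases Int_def)
  have "bracket r s D =
      (\<Sum>\<sigma>\<in>?A. r ^ ?v * s ^ ?m * ((\<Prod>p\<in>over D. c p (\<sigma> p)) * (- 2) ^ state_circles D \<sigma>))"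
    unfolding bracket_def state_value_def state_virtuals_def power_add rVv
    by (simp add: c_def prod.distrib mult_ac)
  also have "\<dots> = r ^ ?v * s ^ ?m * (\<Sum>\<sigma>\<in>?A. (\<Prod>p\<in>over D. c p (\<sigma> p)) * (- 2) ^ state_circles D \<sigma>)"
    by (simp add: sum_distrib_left)
  also have "(\<Sum>\<sigma>\<in>?A. (\<Prod>p\<in>over D. c p (\<sigma> p)) * (- 2) ^ state_circles D \<sigma>) =
      (\<Prod>p\<in>over D. c p Vv - c p Oo) * (- 2) ^ state_circles D (restrict (\<lambda>_. Vv) (over D))"
    by (rule state_sum_binor[OF finite_over])
      (auto simp: c_def skein_coeff_def Let_def state_circles_binor)
  also have "state_circles D (restrict (\<lambda>_. Vv) (over D)) = length (curves D)"
    by (rule virtual_state_circles) simp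
  also have "(\<Prod>p\<in>over D. c p Vv - c p Oo) = (\<Prod>p\<in>over D. if positive D p then K else inverse K)"
    using skein_coeff_diff(2)[OF r, folded K_def] by (simp add: c_def)
  also have "\<dots> = K powi writhe D"
    using finite_over K
    by (simp add: prod.If_cases writhe_def power_int_diff Int_def Collect_neg_eq[symmetric] power_inverse divide_inverse)
  finally have br: "bracket r s D = r ^ ?v * s ^ ?m * (K powi writhe D * (- 2) ^ length (curves D))" .
  have "K powi (- writhe D) * K powi writhe D = 1" using K by (simp add: power_int_minus)
  moreover have "r ^ ?v * K powi (- writhe D) *
      (r ^ ?v * s ^ ?m * (K powi writhe D * (- 2) ^ length (curves D))) =
      (r ^ ?v * r ^ ?v) * (K powi (- writhe D) * K powi writhe D) * (s ^ ?m * (- 2) ^ length (curves D))"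
    by (simp only: mult_ac)
  ultimately have "r ^ ?v * K powi (- writhe D) *
      (r ^ ?v * s ^ ?m * (K powi writhe D * (- 2) ^ length (curves D))) =
      s ^ ?m * (- 2) ^ length (curves D)"
    using rv by simp
  then show ?thesis unfolding Y_def br K_def[symmetric] .
qed


section \<open>Components and wens under the moves\<close>

text \<open>\<open>h\<close> maps \<open>{0..<1}\<close> onto \<open>{h 0..<h 0 + 1}\<close>, again
  a set of representatives modulo 1.\<close>

lemma circle_reparam_bij:
  assumes "circle_reparam h"
  shows "bij_betw (\<lambda>t. frac (h t)) {0..<1} {0..<1}"
proof -
  have cont: "continuous_on UNIV h" and mono: "strict_mono h" and per: "\<And>t. h (t + 1) = h t + 1"
    using assms by (auto simp: circle_reparam_def)
  have le: "h s \<le> h t \<longleftrightarrow> s \<le> t" "h s < h t \<longleftrightarrow> s < t" for s t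
    using mono by (simp_all add: strict_mono_less_eq strict_mono_less)
  have h1: "h 1 = h 0 + 1" using per[of 0] by simp
  have "inj_on (\<lambda>t. frac (h t)) {0..<1}"
  proof (rule inj_onI)
    fix s t :: real assume st: "s \<in> {0..<1}" "t \<in> {0..<1}" "frac (h s) = frac (h t)"
    have "h 0 \<le> h s" "h s < h 0 + 1" "h 0 \<le> h t" "h t < h 0 + 1"
      using st(1,2) by (auto simp: le simp flip: h1)
    moreover obtain n where n: "h s = h t + of_int n" using st(3) by (rule frac_eq_obtain)
    ultimately have "of_int n < (1::real)" "of_int n > (- 1::real)" by linarith+
    then have "n = 0" by linarith
    then show "s = t" using n le(1)[of s t] le(1)[of t s] by simp
  qed
  moreover have "(\<lambda>t. frac (h t)) ` {0..<1} = {0..<1}"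
  proof
    show "{0..<1} \<subseteq> (\<lambda>t. frac (h t)) ` {0..<1}"
    proof
      fix y :: real assume y: "y \<in> {0..<1}"
      \<comment> \<open>The shift that brings \<open>y\<close> into
        \<open>{h 0..<h 0 + 1}\<close>.\<close>
      define n where "n = \<lceil>h 0 - y\<rceil>"
      have n: "h 0 \<le> y + of_int n" "y + of_int n < h 0 + 1" unfolding n_def by linarith+
      obtain t where t: "0 \<le> t" "t \<le> 1" "h t = y + of_int n"
        using IVT'[of h 0 "y + of_int n" 1] n h1 continuous_on_subset[OF cont] by auto
      have "t < 1" using t n(2) h1 le(2)[of t 1] by simp
      moreover have "frac (h t) = y" using t(3) y by (simp add: frac_eq)
      ultimately show "y \<in> (\<lambda>t. frac (h t)) ` {0..<1}" using t(1) by force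
    qed
  qed (auto simp: frac_lt_1)
  ultimately show ?thesis by (simp add: bij_betw_def)
qed

lemma planar_isotopic_invariants:
  assumes "is_diagram D" "is_diagram D'" "planar_isotopic D D'"
  shows "length (curves D) = length (curves D')" "card (wens D) = card (wens D')"
proof -
  obtain \<pi> h where \<pi>: "bij_betw \<pi> {..<length (curves D)} {..<length (curves D')}"
    and h: "\<And>i. i < length (curves D) \<Longrightarrow> circle_reparam (h i)"
    and wens: "\<And>i t. i < length (curves D) \<Longrightarrow> t \<in> {0..<1} \<Longrightarrow>
      (\<pi> i, t) \<in> wens D' \<longleftrightarrow> (i, frac (h i t)) \<in> wens D"
    using assms(3) unfolding planar_isotopic_def by metis
  show "length (curves D) = length (curves D')"
    using bij_betw_same_card[OF \<pi>] by simp
  have sub: "wens D \<subseteq> points D" "wens D' \<subseteq> points D'" using assms by (auto simp: is_diagram_def)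
  \<comment> \<open>Component indices are those of \<open>D\<close>, parameters those of
    \<open>D'\<close>: this set maps bijectively to both sets of wens, by \<open>\<pi>\<close> on
    the index or by the reparametrization on the parameter.\<close>
  define W where "W = {(i, t). i < length (curves D) \<and> t \<in> {0..<1} \<and> (\<pi> i, t) \<in> wens D'}"
  have "bij_betw (\<lambda>(i, t). (\<pi> i, t)) W (wens D')"
    unfolding bij_betw_def
  proof
    show "inj_on (\<lambda>(i, t). (\<pi> i, t)) W"
      using \<pi> by (auto simp: inj_on_def W_def bij_betw_def)
    show "(\<lambda>(i, t). (\<pi> i, t)) ` W = wens D'"
    proof
      show "wens D' \<subseteq> (\<lambda>(i, t). (\<pi> i, t)) ` W"
      proof
        fix p assume p: "p \<in> wens D'"
        then obtain j t where jt: "p = (j, t)" "j < length (curves D')" "t \<in> {0..<1}"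
          using sub(2) by (auto simp: points_def)
        then obtain i where "i < length (curves D)" "\<pi> i = j"
          using \<pi> unfolding bij_betw_def by (metis imageE lessThan_iff)
        then show "p \<in> (\<lambda>(i, t). (\<pi> i, t)) ` W" using jt p by (force simp: W_def)
      qed
    qed (auto simp: W_def)
  qed
  then have "card W = card (wens D')" by (rule bij_betw_same_card)
  moreover have "bij_betw (\<lambda>(i, t). (i, frac (h i t))) W (wens D)"
    unfolding bij_betw_def
  proof
    have inj: "inj_on (\<lambda>t. frac (h i t)) {0..<1}"
      and surj: "(\<lambda>t. frac (h i t)) ` {0..<1} = {0..<1}" if "i < length (curves D)" for i
      using circle_reparam_bij[OF h[OF that]] by (auto simp: bij_betw_def)
    show "inj_on (\<lambda>(i, t). (i, frac (h i t))) W"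
      using inj by (auto simp: inj_on_def W_def)
    show "(\<lambda>(i, t). (i, frac (h i t))) ` W = wens D"
    proof
      show "wens D \<subseteq> (\<lambda>(i, t). (i, frac (h i t))) ` W"
      proof
        fix p assume p: "p \<in> wens D"
        then obtain i s where ps: "p = (i, s)" "i < length (curves D)" "s \<in> {0..<1}"
          using sub(1) by (auto simp: points_def)
        then obtain t where "t \<in> {0..<1}" "s = frac (h i t)" using surj[of i] by blast
        then show "p \<in> (\<lambda>(i, t). (i, frac (h i t))) ` W"
          using ps p wens by (force simp: W_def)
      qed
    qed (use wens in \<open>auto simp: W_def\<close>)
  qed
  then have "card W = card (wens D)" by (rule bij_betw_same_card)
  ultimately show "card (wens D) = card (wens D')" by simp
qed

text \<open>The field \<open>twens\<close> may be any set of points; only wens on actual strands can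
  appear in a diagram.\<close>

definition tangle_wens :: "tangle \<Rightarrow> point set" where
  "tangle_wens T = twens T \<inter> {..<length (strands T)} \<times> {-1..1}"

text \<open>Each \<open>\<rho> k\<close> is a bijection that matches wens, and the parameter
  intervals are disjoint, so no wen is counted for two strands.\<close>

lemma sits_in_wens:
  assumes "sits_in \<phi> i \<alpha> \<beta> \<rho> T D"
  shows "card (wens D \<inter> (\<Union>k<length (strands T). {i k} \<times> {\<alpha> k..\<beta> k})) = card (tangle_wens T)"
proof -
  let ?n = "length (strands T)"
  have \<rho>: "\<And>k. k < ?n \<Longrightarrow> bij_betw (\<rho> k) {\<alpha> k..\<beta> k} {-1..1}"
    and wens: "\<And>k t. k < ?n \<Longrightarrow> t \<in> {\<alpha> k..\<beta> k} \<Longrightarrow>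
      (i k, t) \<in> wens D \<longleftrightarrow> (k, \<rho> k t) \<in> twens T"
    and disj: "disjoint_family_on (\<lambda>k. {i k} \<times> {\<alpha> k..\<beta> k}) {..<?n}"
    using assms unfolding sits_in_def by blast+
  define W where "W = {(k, t). k < ?n \<and> t \<in> {\<alpha> k..\<beta> k} \<and> (i k, t) \<in> wens D}"
  have "bij_betw (\<lambda>(k, t). (i k, t)) W (wens D \<inter> (\<Union>k<?n. {i k} \<times> {\<alpha> k..\<beta> k}))"
    unfolding bij_betw_def
  proof
    show "inj_on (\<lambda>(k, t). (i k, t)) W"
    proof (rule inj_onI, clarsimp simp: W_def)
      fix k l t assume "k < ?n" "l < ?n" "i k = i l" "\<alpha> k \<le> t" "t \<le> \<beta> k" "\<alpha> l \<le> t" "t \<le> \<beta> l"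
      then have "(i k, t) \<in> ({i k} \<times> {\<alpha> k..\<beta> k}) \<inter> ({i l} \<times> {\<alpha> l..\<beta> l})" by simp
      then show "k = l"
        using disj \<open>k < ?n\<close> \<open>l < ?n\<close> unfolding disjoint_family_on_def by (metis empty_iff lessThan_iff)
    qed
    show "(\<lambda>(k, t). (i k, t)) ` W = wens D \<inter> (\<Union>k<?n. {i k} \<times> {\<alpha> k..\<beta> k})"
      by (force simp: W_def)
  qed
  then have "card W = card (wens D \<inter> (\<Union>k<?n. {i k} \<times> {\<alpha> k..\<beta> k}))"
    by (rule bij_betw_same_card)
  moreover have "bij_betw (\<lambda>(k, t). (k, \<rho> k t)) W (tangle_wens T)"
    unfolding bij_betw_def
  proof
    have inj: "inj_on (\<rho> k) {\<alpha> k..\<beta> k}" and img: "\<rho> k ` {\<alpha> k..\<beta> k} = {-1..1}" if "k < ?n" for k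
      using \<rho>[OF that] by (auto simp: bij_betw_def)
    show "inj_on (\<lambda>(k, t). (k, \<rho> k t)) W"
      using inj by (auto simp: inj_on_def W_def)
    show "(\<lambda>(k, t). (k, \<rho> k t)) ` W = tangle_wens T"
    proof
      show "(\<lambda>(k, t). (k, \<rho> k t)) ` W \<subseteq> tangle_wens T"
        using wens img by (fastforce simp: W_def tangle_wens_def)
      show "tangle_wens T \<subseteq> (\<lambda>(k, t). (k, \<rho> k t)) ` W"
      proof
        fix p assume "p \<in> tangle_wens T"
        then obtain k s where ks: "p = (k, s)" "k < ?n" "s \<in> {-1..1}" "(k, s) \<in> twens T"
          by (auto simp: tangle_wens_def)
        then obtain t where "t \<in> {\<alpha> k..\<beta> k}" "s = \<rho> k t" using img[of k] by blast
        then show "p \<in> (\<lambda>(k, t). (k, \<rho> k t)) ` W"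
          using ks wens by (force simp: W_def)
      qed
    qed
  qed
  then have "card W = card (tangle_wens T)" by (rule bij_betw_same_card)
  ultimately show ?thesis by simp
qed

text \<open>Only \<open>T1\<close> changes the number of wens, from two to none; the slides
  \<open>T2\<close>, \<open>T3\<close> and \<open>T4\<close> keep a single one.\<close>

lemma moves_invariants:
  assumes "moves T T'"
  shows "length (strands T) = length (strands T')"
    and "even (card (tangle_wens T)) \<longleftrightarrow> even (card (tangle_wens T'))"
  using assms
  by (induction; auto simp: tangle_wens_def kink_def line_def cross1_def cross2_def cross3_def
      parallel2_def triangle_def braidlike_def)+

lemma local_move_invariants:
  assumes D: "is_diagram D" "is_diagram D'" and "moves T T'" "local_move T T' D D'"
  shows "length (curves D) = length (curves D')" "even (card (wens D)) \<longleftrightarrow> even (card (wens D'))"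
proof -
  obtain \<phi> i \<alpha> \<beta> \<rho> \<rho>' where
    sits: "sits_in \<phi> i \<alpha> \<beta> \<rho> T D" "sits_in \<phi> i \<alpha> \<beta> \<rho>' T' D'"
    and len: "length (curves D) = length (curves D')"
    and out: "\<forall>p \<in> points D - (\<Union>k<length (strands T). {i k} \<times> {\<alpha> k..\<beta> k}).
      p \<in> wens D \<longleftrightarrow> p \<in> wens D'"
    using assms(4) unfolding local_move_def by blast
  define U where "U = (\<Union>k<length (strands T). {i k} \<times> {\<alpha> k..\<beta> k})"
  show "length (curves D) = length (curves D')" by (rule len)
  have "points D = points D'" by (simp add: points_def len)
  then have sub: "wens D \<subseteq> points D" "wens D' \<subseteq> points D"
    and fin: "finite (wens D)" "finite (wens D')"
    using D by (auto simp: is_diagram_def)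
  have "wens D - U = wens D' - U" using sub out unfolding U_def by blast
  \<comment> \<open>Equal numbers of strands make \<open>U\<close> the part inside the disk for both
    diagrams.\<close>
  moreover have "even (card (wens D \<inter> U)) \<longleftrightarrow> even (card (wens D' \<inter> U))"
    using sits_in_wens[OF sits(1)] sits_in_wens[OF sits(2)] moves_invariants(2)[OF assms(3)]
    unfolding U_def moves_invariants(1)[OF assms(3)] by simp
  ultimately show "even (card (wens D)) \<longleftrightarrow> even (card (wens D'))"
    using card_Int_Diff[OF fin(1), of U] card_Int_Diff[OF fin(2), of U] by (metis even_add)
qed

lemma elementary_move_invariants:
  assumes "elementary_move D D'"
  shows "length (curves D) = length (curves D') \<and> (even (card (wens D)) \<longleftrightarrow> even (card (wens D')))"
  using assms planar_isotopic_invariants local_move_invariants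
  unfolding elementary_move_def by metis

lemma same_link_invariants:
  assumes "same_link D D'"
  shows "length (curves D) = length (curves D') \<and> (even (card (wens D)) \<longleftrightarrow> even (card (wens D')))"
  using assms unfolding same_link_def
  by (induction rule: equivclp_induct) (use elementary_move_invariants in \<open>simp, metis\<close>)

theorem theorem2:
  fixes r s :: ratfun and L L' :: diagram
  assumes "r \<in> {1, -1}" and "s \<in> {1, -1}"
    and "is_diagram L" and "is_diagram L'"
    and "same_link L L'"
  shows "Y r s L = Y r s L'"
proof -
  \<comment> \<open>Since \<open>s\<close> is 1 or -1, its power depends only on the parity of the
    exponent.\<close>
  have "s ^ card (wens L) = s ^ card (wens L')"
    using assms(2) same_link_invariants[OF assms(5)] by (auto simp: minus_one_power_iff)
  then show ?thesis
    using assms same_link_invariants[OF assms(5)] by (simp add: Y_eq)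
qed

end
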